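(* There is a polynomial $P$ such that the following holds. For every finite general-sum multiplayer extensive-form game $\Gamma$ with perfect recall, there exist uncoupled no-regret learning dynamics (one learning algorithm for each player) such that, for every horizon $T\ge 1$, when all players follow these dynamics for $T$ rounds, the correlated distribution of play is an $\epsilon$-EFCE with $\epsilon \le P(|\Gamma|)\, T^{-3/4}$. Here $|\Gamma|$ denotes the size of the description of the game.
   Context: **Games.** A finite extensive-form game has a rooted game tree with node set $\mathcal H$, players $[n]=\{1,\dots,n\}$ and a chance player $c$ acting with fixed probabilities. $\mathcal Z$ is the set of leaves, $u_i:\mathcal Z\to[-1,1]$ is the utility of player $i$, and $p_c(z)$ is the product of the chance probabilities on the path from the root to $z$. The decision nodes of player $i$ are partitioned into information sets $\mathcal J_i$; $\mathcal A_j$ is the finite nonempty action set at $j\in\mathcal J_i$. The game has perfect recall (all nodes of $j$ have the same history of player $i$'s own information sets and actions). For $j,j'\in\mathcal J_i$, $j\prec j'$ if some path from the root to a node of $j'$ passes through a node of $j$ (and $j \ne j'$). The sequences of player $i$ are $\Sigma_i=\{(j,a):j\in\mathcal J_i,a\in\mathcal A_j\}\cup\{\varnothing\}$, and $\Sigma_i^*=\Sigma_i\setminus\{\varnothing\}$. The parent sequence $\sigma_j\in\Sigma_i$ is the last sequence of player $i$ on the path from the root to any node of $j$ ($\varnothing$ if there is none); $\sigma_{i,z}$ is the last sequence of player $i$ on the path to $z\in\mathcal Z$. For $\sigma=(j',a')$, write $\sigma\succeq j$ if $j'=j$ or $j\prec j'$ (and $\varnothing\not\succeq j$). The size $|\Gamma|$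 can be taken to be $n$ plus the number of nodes of the game tree. **Strategies.** $\mathcal Q_i=\{q\in\mathbb R^{\Sigma_i}_{\ge0}: q[\varnothing]=1,\ q[\sigma_j]=\sum_{a\in\mathcal A_j}q[(j,a)]\ \forall j\in\mathcal J_i\}$ and $\Pi_i=\mathcal Q_i\cap\{0,1\}^{\Sigma_i}$. For $j\in\mathcal J_i$ let $\Sigma_j=\{\sigma\in\Sigma_i:\sigma\succeq j\}$, and let $\mathcal Q_j$ be the set of $q\in\mathbb R_{\ge0}^{\Sigma_j}$ with $\sum_{a\in\mathcal A_j}q[(j,a)]=1$ and $q[\sigma_{j'}]=\sum_{a\in\mathcal A_{j'}}q[(j',a)]$ for all $j'\succ j$; $\Pi_j=\mathcal Q_j\cap\{0,1\}^{\Sigma_j}$. Let $\Pi=\Pi_1\times\dots\times\Pi_n$, and $u_i(\pi)=\sum_{z\in\mathcal Z}p_c(z)u_i(z)\prod_{k\in[n]}\pi_k[\sigma_{k,z}]$, extended by the same formula to $\mathcal Q_1\times\dots\times\mathcal Q_n$. **Trigger deviations and EFCE.** For $\hat\sigma=(j,a)\in\Sigma_i^*$ and $\hat\pi_i\in\Pi_j$, the trigger deviation function $\phi_{\hat\sigma\to\hat\pi_i}$ is the linear map with: $\phi_{\hat\sigma\to\hat\pi_i}(\pi_i)=\pi_i$ for $\pi_i\in\Pi_i$ with $\pi_i[\hat\sigma]=0$; and if $\pi_i[\hat\sigma]=1$, then $\phi_{\hat\sigma\to\hat\pi_i}(\pi_i)[\sigma]=\pi_i[\sigma]$ for $\sigma\not\succeq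 j$ and $=\hat\pi_i[\sigma]$ for $\sigma\succeq j$. $\Psi_i$ is the set of all trigger deviation functions of player $i$. A distribution $\mu\in\Delta(\Pi)$ is an $\epsilon$-EFCE (extensive-form correlated equilibrium) if $\mathbb E_{\pi\sim\mu}[u_i(\phi(\pi_i),\pi_{-i})-u_i(\pi)]\le\epsilon$ for every $i\in[n]$ and every $\phi\in\Psi_i$. **Learning dynamics.** In each round $t=1,\dots,T$, each player $i$ outputs $q_i^{(t)}\in\mathcal Q_i$ and then observes the linear utility function $\ell_i^{(t)}:q_i\mapsto u_i(q_i,q_{-i}^{(t)})$. The dynamics are uncoupled if $q_i^{(t)}$ depends only on player $i$'s own decision tree, the horizon $T$, and player $i$'s previously observed utility functions $\ell_i^{(1)},\dots,\ell_i^{(t-1)}$. They are no-regret if, under any sequence of bounded utility functions, the regret $\max_{\phi\in\Psi_i}\sum_{t=1}^T\ell_i^{(t)}(\phi(q_i^{(t)}))-\sum_{t=1}^T\ell_i^{(t)}(q_i^{(t)})$ of each player grows sublinearly in $T$. The correlated distribution of play is $\frac1T\sum_{t=1}^T\mu_1^{(t)}\otimes\dots\otimes\mu_n^{(t)}$, where $\mu_i^{(t)}$ is any distribution on $\Pi_i$ with $\mathbb E_{\pi_i\sim\mu_i^{(t)}}[\pi_i]=q_i^{(t)}$. *)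

theory Defs
  imports
    "HOL-Probability.Probability"
    "HOL-Probability.Product_PMF"
    "HOL-Library.Landau_Symbols"
    "HOL-Library.Sublist"
    "HOL-Computational_Algebra.Polynomial"
begin

section \<open>Extensive-form games\<close>

text \<open>
  A node of the game tree is the list of actions leading to it from the root \<open>[]\<close>, so the
  ancestors of a node are its prefixes. The players are \<open>1, \<dots>, n\<close>; chance moves at the nodes
  where \<^term>\<open>turn\<close> is \<^const>\<open>None\<close>. Information sets are given by labels: an information set
  of player \<open>i\<close> is the set of decision nodes of \<open>i\<close> carrying a common label.
  Labels, actions and players are natural numbers; up to renaming this covers all finite games.
\<close>

type_synonym node = "nat list"

record game =
  num_players :: nat
  nodes :: "node set"
  turn :: "node \<Rightarrow> nat option"
  info_label :: "node \<Rightarrow> nat"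
  chance_prob :: "node \<Rightarrow> nat \<Rightarrow> real"
  payoff :: "nat \<Rightarrow> node \<Rightarrow> real"

definition players :: "game \<Rightarrow> nat set" where
  "players G = {1..num_players G}"

definition node_actions :: "game \<Rightarrow> node \<Rightarrow> nat set" where
  "node_actions G h = {a. h @ [a] \<in> nodes G}"

definition leaves :: "game \<Rightarrow> node set" where
  "leaves G = {z \<in> nodes G. node_actions G z = {}}"

definition inner_nodes :: "game \<Rightarrow> node set" where
  "inner_nodes G = nodes G - leaves G"

definition infoset_nodes :: "game \<Rightarrow> nat \<Rightarrow> nat \<Rightarrow> node set" where
  "infoset_nodes G i j = {h \<in> inner_nodes G. turn G h = Some i \<and> info_label G h = j}"

definition finite_game :: "game \<Rightarrow> bool" where
  "finite_game G \<longleftrightarrow>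
     num_players G \<ge> 1 \<and>
     finite (nodes G) \<and> [] \<in> nodes G \<and>
     (\<forall>h \<in> nodes G. \<forall>h'. prefix h' h \<longrightarrow> h' \<in> nodes G) \<and>
     (\<forall>h \<in> inner_nodes G. \<forall>i. turn G h = Some i \<longrightarrow> i \<in> players G) \<and>
     (\<forall>h \<in> inner_nodes G. turn G h = None \<longrightarrow>
        (\<forall>a \<in> node_actions G h. chance_prob G h a \<ge> 0) \<and>
        (\<Sum>a\<in>node_actions G h. chance_prob G h a) = 1) \<and>
     (\<forall>i \<in> players G. \<forall>z \<in> leaves G. -1 \<le> payoff G i z \<and> payoff G i z \<le> 1) \<and>
     (\<forall>i \<in> players G. \<forall>j. \<forall>h \<in> infoset_nodes G i j. \<forall>h' \<in> infoset_nodes G i j.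
        node_actions G h = node_actions G h')"

text \<open>
  A sequence is \<^term>\<open>Some (j, a)\<close> for an action \<open>a\<close> at the information set labelled \<open>j\<close>;
  \<^const>\<open>None\<close> is the empty sequence.
\<close>

type_synonym sequence = "(nat \<times> nat) option"

definition own_history :: "game \<Rightarrow> nat \<Rightarrow> node \<Rightarrow> (nat \<times> nat) list" where
  "own_history G i h =
     map (\<lambda>k. (info_label G (take k h), h ! k))
       (filter (\<lambda>k. turn G (take k h) = Some i) [0..<length h])"

definition last_sequence :: "game \<Rightarrow> nat \<Rightarrow> node \<Rightarrow> sequence" where
  "last_sequence G i h =
     (if own_history G i h = [] then None else Some (last (own_history G i h)))"

definition perfect_recall :: "game \<Rightarrow> bool" where
  "perfect_recall G \<longleftrightarrow>
     (\<forall>i \<in> players G. \<forall>j. \<forall>h \<in> infoset_nodes G i j. \<forall>h' \<in> infoset_nodes G i j.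
        own_history G i h = own_history G i h')"

definition game_size :: "game \<Rightarrow> nat" where
  "game_size G = num_players G + card (nodes G)"

definition chance_reach :: "game \<Rightarrow> node \<Rightarrow> real" where
  "chance_reach G z =
     (\<Prod>k | k < length z \<and> turn G (take k z) = None. chance_prob G (take k z) (z ! k))"

section \<open>Decision trees and sequence-form strategies\<close>

text \<open>
  The decision tree of a player is everything a learning algorithm may know about the game.
  The components are given fixed dummy values at labels that are not information sets of the
  player, so that two games in which a player has the same decision problem yield equal records.
\<close>

record decision_tree =
  infosets :: "nat set"
  actions :: "nat \<Rightarrow> nat set"
  parent :: "nat \<Rightarrow> sequence"
  precedes :: "nat \<Rightarrow> nat \<Rightarrow> bool"

definition decision_tree_of :: "game \<Rightarrow> nat \<Rightarrow> decision_tree" where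
  "decision_tree_of G i =
     (let J = {j. infoset_nodes G i j \<noteq> {}}; rep = (\<lambda>j. SOME h. h \<in> infoset_nodes G i j) in
      \<lparr> infosets = J,
        actions = (\<lambda>j. if j \<in> J then node_actions G (rep j) else {}),
        parent = (\<lambda>j. if j \<in> J then last_sequence G i (rep j) else None),
        precedes = (\<lambda>j j'. j \<noteq> j' \<and>
          (\<exists>h \<in> infoset_nodes G i j. \<exists>h' \<in> infoset_nodes G i j'. prefix h h')) \<rparr>)"

definition sequences :: "decision_tree \<Rightarrow> sequence set" where
  "sequences D = {Some (j, a) | j a. j \<in> infosets D \<and> a \<in> actions D j} \<union> {None}"

definition seq_at_or_below :: "decision_tree \<Rightarrow> nat \<Rightarrow> sequence \<Rightarrow> bool" where
  "seq_at_or_below D j s \<longleftrightarrow> (\<exists>j' a'. s = Some (j', a') \<and> (j' = j \<or> precedes D j j'))"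

definition sequences_from :: "decision_tree \<Rightarrow> nat \<Rightarrow> sequence set" where
  "sequences_from D j = {s \<in> sequences D. seq_at_or_below D j s}"

text \<open>
  A real vector indexed by a set of sequences is a function that vanishes outside that set.
\<close>

type_synonym strategy = "sequence \<Rightarrow> real"

definition strategies :: "decision_tree \<Rightarrow> strategy set" where
  "strategies D = {q.
     (\<forall>s. q s \<ge> 0) \<and> (\<forall>s. s \<notin> sequences D \<longrightarrow> q s = 0) \<and>
     q None = 1 \<and>
     (\<forall>j \<in> infosets D. q (parent D j) = (\<Sum>a\<in>actions D j. q (Some (j, a))))}"

definition pure_strategies :: "decision_tree \<Rightarrow> strategy set" where
  "pure_strategies D = {q \<in> strategies D. \<forall>s. q s \<in> {0, 1}}"

definition strategies_from :: "decision_tree \<Rightarrow> nat \<Rightarrow> strategy set" where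
  "strategies_from D j = {q.
     (\<forall>s. q s \<ge> 0) \<and> (\<forall>s. s \<notin> sequences_from D j \<longrightarrow> q s = 0) \<and>
     (\<Sum>a\<in>actions D j. q (Some (j, a))) = 1 \<and>
     (\<forall>j' \<in> infosets D. precedes D j j' \<longrightarrow>
        q (parent D j') = (\<Sum>a\<in>actions D j'. q (Some (j', a))))}"

definition pure_strategies_from :: "decision_tree \<Rightarrow> nat \<Rightarrow> strategy set" where
  "pure_strategies_from D j = {q \<in> strategies_from D j. \<forall>s. q s \<in> {0, 1}}"

type_synonym profile = "nat \<Rightarrow> strategy"

definition pure_profiles :: "game \<Rightarrow> profile set" where
  "pure_profiles G = Pi\<^sub>E (players G) (\<lambda>i. pure_strategies (decision_tree_of G i))"

definition expected_utility :: "game \<Rightarrow> nat \<Rightarrow> profile \<Rightarrow> real" where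
  "expected_utility G i q =
     (\<Sum>z\<in>leaves G. chance_reach G z * payoff G i z *
        (\<Prod>k\<in>players G. q k (last_sequence G k z)))"

section \<open>Trigger deviations and correlated equilibria\<close>

definition linear_map :: "decision_tree \<Rightarrow> (strategy \<Rightarrow> strategy) \<Rightarrow> bool" where
  "linear_map D f \<longleftrightarrow>
     (\<exists>M. \<forall>q. f q = (\<lambda>s. if s \<in> sequences D then \<Sum>s'\<in>sequences D. M s s' * q s' else 0))"

text \<open>
  The condition below determines the linear map only on the span of the pure strategies. As that
  span contains all strategies, and the maps are applied to nothing else, it does not matter that
  all linear extensions are admitted.
\<close>

definition is_trigger_deviation ::
    "decision_tree \<Rightarrow> nat \<Rightarrow> nat \<Rightarrow> strategy \<Rightarrow> (strategy \<Rightarrow> strategy) \<Rightarrow> bool" where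
  "is_trigger_deviation D j a r f \<longleftrightarrow>
     linear_map D f \<and>
     (\<forall>p \<in> pure_strategies D.
        (p (Some (j, a)) = 0 \<longrightarrow> f p = p) \<and>
        (p (Some (j, a)) = 1 \<longrightarrow> f p = (\<lambda>s. if seq_at_or_below D j s then r s else p s)))"

definition trigger_deviations :: "decision_tree \<Rightarrow> (strategy \<Rightarrow> strategy) set" where
  "trigger_deviations D = {f. \<exists>j \<in> infosets D. \<exists>a \<in> actions D j.
     \<exists>r \<in> pure_strategies_from D j. is_trigger_deviation D j a r f}"

definition is_EFCE :: "game \<Rightarrow> real \<Rightarrow> profile pmf \<Rightarrow> bool" where
  "is_EFCE G \<epsilon> \<mu> \<longleftrightarrow>
     set_pmf \<mu> \<subseteq> pure_profiles G \<and>
     (\<forall>i \<in> players G. \<forall>f \<in> trigger_deviations (decision_tree_of G i).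
        measure_pmf.expectation \<mu>
          (\<lambda>p. expected_utility G i (p(i := f (p i))) - expected_utility G i p) \<le> \<epsilon>)"

section \<open>Learning dynamics\<close>

text \<open>
  A utility function is a linear function on the strategy set. It is \<^const>\<open>undefined\<close> elsewhere,
  so that observing it reveals its values on strategies only.
\<close>

type_synonym utility_fun = "strategy \<Rightarrow> real"

definition linear_utility :: "decision_tree \<Rightarrow> utility_fun \<Rightarrow> bool" where
  "linear_utility D l \<longleftrightarrow>
     (\<exists>g. l = restrict (\<lambda>q. \<Sum>s\<in>sequences D. g s * q s) (strategies D))"

definition observed_utility :: "game \<Rightarrow> nat \<Rightarrow> profile \<Rightarrow> utility_fun" where
  "observed_utility G i q =
     restrict (\<lambda>x. expected_utility G i (q(i := x))) (strategies (decision_tree_of G i))"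

text \<open>
  An algorithm maps the horizon and the list of utility functions observed so far to the next
  strategy. Rounds are numbered \<open>0, \<dots>, T - 1\<close>.
\<close>

type_synonym algorithm = "nat \<Rightarrow> utility_fun list \<Rightarrow> strategy"

definition learning_algorithm :: "decision_tree \<Rightarrow> algorithm \<Rightarrow> bool" where
  "learning_algorithm D A \<longleftrightarrow>
     (\<forall>T ls. length ls < T \<longrightarrow> (\<forall>l \<in> set ls. linear_utility D l) \<longrightarrow> A T ls \<in> strategies D)"

definition regret_against ::
    "algorithm \<Rightarrow> nat \<Rightarrow> (nat \<Rightarrow> utility_fun) \<Rightarrow> (strategy \<Rightarrow> strategy) \<Rightarrow> real" where
  "regret_against A T l f =
     (\<Sum>t<T. l t (f (A T (map l [0..<t])))) - (\<Sum>t<T. l t (A T (map l [0..<t])))"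

text \<open>
  As the algorithm may depend on the horizon \<open>T\<close>, so may the utility functions it faces. Hence
  sublinearity means a sublinear bound on the worst-case regret over utility functions bounded
  by \<open>B\<close>. Bounding the regret against every \<open>f\<close> bounds the maximum over \<open>f\<close>, and imposes
  nothing when the player has no information sets.
\<close>

definition no_regret :: "decision_tree \<Rightarrow> algorithm \<Rightarrow> bool" where
  "no_regret D A \<longleftrightarrow>
     (\<forall>B. \<exists>R. R \<in> o(\<lambda>T. real T) \<and>
        (\<forall>T l. (\<forall>t<T. linear_utility D (l t) \<and> (\<forall>q \<in> strategies D. \<bar>l t q\<bar> \<le> B)) \<longrightarrow>
           (\<forall>f \<in> trigger_deviations D. regret_against A T l f \<le> R T)))"

text \<open>
  Dynamics assign an algorithm to each player of each game. Being uncoupled is a property across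
  games: players with the same decision tree run the same algorithm, whatever the rest of the game.
\<close>

type_synonym dynamics = "game \<Rightarrow> nat \<Rightarrow> algorithm"

definition uncoupled :: "dynamics \<Rightarrow> bool" where
  "uncoupled dyn \<longleftrightarrow>
     (\<exists>alg. \<forall>G. finite_game G \<and> perfect_recall G \<longrightarrow>
        (\<forall>i \<in> players G. dyn G i = alg (decision_tree_of G i)))"

fun play :: "game \<Rightarrow> (nat \<Rightarrow> algorithm) \<Rightarrow> nat \<Rightarrow> nat \<Rightarrow> profile" where
  "play G A T t = (\<lambda>i. A i T (map (\<lambda>s. observed_utility G i (play G A T s)) [0..<t]))"

declare play.simps [simp del]

definition represents_play ::
    "game \<Rightarrow> (nat \<Rightarrow> algorithm) \<Rightarrow> nat \<Rightarrow> (nat \<Rightarrow> nat \<Rightarrow> strategy pmf) \<Rightarrow> bool" where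
  "represents_play G A T \<mu> \<longleftrightarrow>
     (\<forall>t<T. \<forall>i \<in> players G.
        set_pmf (\<mu> t i) \<subseteq> pure_strategies (decision_tree_of G i) \<and>
        (\<forall>s \<in> sequences (decision_tree_of G i).
           measure_pmf.expectation (\<mu> t i) (\<lambda>p. p s) = play G A T t i s))"

definition correlated_play :: "game \<Rightarrow> nat \<Rightarrow> (nat \<Rightarrow> nat \<Rightarrow> strategy pmf) \<Rightarrow> profile pmf" where
  "correlated_play G T \<mu> =
     bind_pmf (pmf_of_set {..<T}) (\<lambda>t. Pi_pmf (players G) undefined (\<mu> t))"

end

theory Submission
  imports Defs "HOL-Real_Asymp.Real_Asymp"
begin

text \<open>
  Each player runs exponential weights with learning rate \<open>T\<close> powr \<open>-1/4\<close> over all trigger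
  deviations and all constant maps, predicting that the utilities of the last round recur, and
  plays a fixed point of the resulting mixture of deviations. The regret is then at most
  \<open>O(T powr (1/4))\<close> plus a multiple of the learning rate times the sum of the squared changes of
  the utilities from round to round, so it suffices that play moves by \<open>O(T powr (-1/4))\<close> per round.

  The weights move by a factor \<open>exp (O(T powr (-1/4)))\<close>, and the fixed point inherits this: after
  a fixed positive rescaling of the sequences it is the stationary vector of a Markov chain on
  sequences whose transition probabilities are nonnegative combinations of the weights. The
  constant maps make the chain positive. Exchanging the rows of such a chain one by one shows that
  perturbing all entries by a factor \<open>c\<close> changes the stationary vector by at most a factor \<open>c ^ (2 n)\<close>, where
  \<open>n\<close> is the number of states. Hence there is no exponential loss in the depth of the tree.
\<close>

section \<open>Perturbation of stationary vectors\<close>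

text \<open>The learning rate \<open>e\<close> balances two terms: the regret is of order
  \<open>1 / e + e * T * d^2\<close>, where \<open>d\<close> is the change of the utilities per
  round, and stability makes \<open>d\<close> of order \<open>e\<close>. So \<open>1 / e\<close>
  meets \<open>T * e^3\<close> at \<open>e = T powr (-1/4)\<close>, and dividing the regret by
  \<open>T\<close> gives the exponent -3/4. The obstacle is the dependence on the game. That there
  are exponentially many deviations costs only a logarithm. The fixed point is more delicate: its
  entries and the spectral gap of its chain can be very small, and an additive perturbation bound
  would involve their inverses. Hence the relative bound. The Markov chain tree theorem explains its
  shape: the stationary vector is a quotient of polynomials in the transition probabilities with
  nonnegative coefficients and degree below the number of states. Exchanging rows gives such a bound
  without counting trees. Relative bounds also survive the product over players; they become
  differences only at the leaves, where all reach probabilities are at most 1.\<close>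

definition positive_stochastic :: "'a set \<Rightarrow> ('a \<Rightarrow> 'a \<Rightarrow> real) \<Rightarrow> bool" where
  "positive_stochastic S P \<longleftrightarrow>
     (\<forall>a\<in>S. \<forall>b\<in>S. 0 < P a b) \<and> (\<forall>a\<in>S. (\<Sum>b\<in>S. P a b) = 1)"

definition stationary :: "'a set \<Rightarrow> ('a \<Rightarrow> 'a \<Rightarrow> real) \<Rightarrow> ('a \<Rightarrow> real) \<Rightarrow> bool" where
  "stationary S P v \<longleftrightarrow> (\<forall>b\<in>S. v b = (\<Sum>a\<in>S. v a * P a b))"

lemma stationaryD:
  "stationary S P v \<Longrightarrow> b \<in> S \<Longrightarrow> (\<Sum>a\<in>S. v a * P a b) = v b"
  unfolding stationary_def by metis

text \<open>Doeblin's minorisation: every row dominates the column minima \<open>m\<close>, and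
  against a vector of total mass 0 this common part cancels. What remains of each row has mass
  \<open>1 - (\<Sum>b\<in>S. m b)\<close>, which is the factor \<open>c\<close>.\<close>

lemma positive_stochastic_contraction:
  fixes P :: "'a \<Rightarrow> 'a \<Rightarrow> real"
  assumes fin: "finite S" and ne: "S \<noteq> {}" and P: "positive_stochastic S P"
  obtains c where "0 \<le> c" "c < 1"
    "\<And>v. (\<Sum>a\<in>S. v a) = 0 \<Longrightarrow> (\<Sum>b\<in>S. \<bar>\<Sum>a\<in>S. v a * P a b\<bar>) \<le> c * (\<Sum>a\<in>S. \<bar>v a\<bar>)"
proof -
  define m where "m b = Min ((\<lambda>a. P a b) ` S)" for b
  have m_le: "m b \<le> P a b" if "a \<in> S" for a b
    using fin that by (auto simp: m_def)
  have m_pos: "0 < m b" if "b \<in> S" for b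
    using fin ne that P by (auto simp: m_def positive_stochastic_def)
  obtain s where s: "s \<in> S" using ne by blast
  have "(\<Sum>b\<in>S. m b) \<le> (\<Sum>b\<in>S. P s b)"
    by (intro sum_mono m_le s)
  then have le1: "(\<Sum>b\<in>S. m b) \<le> 1"
    using P s by (auto simp: positive_stochastic_def)
  have gt0: "0 < (\<Sum>b\<in>S. m b)"
    using fin ne m_pos by (intro sum_pos) auto
  show thesis
  proof (rule that[of "1 - (\<Sum>b\<in>S. m b)"])
    fix v :: "'a \<Rightarrow> real"
    assume v: "(\<Sum>a\<in>S. v a) = 0"
    have "(\<Sum>b\<in>S. \<bar>\<Sum>a\<in>S. v a * P a b\<bar>) \<le> (\<Sum>b\<in>S. \<Sum>a\<in>S. \<bar>v a\<bar> * (P a b - m b))"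
    proof (rule sum_mono)
      fix b
      have "(\<Sum>a\<in>S. v a * P a b) = (\<Sum>a\<in>S. v a * (P a b - m b))"
        using v by (simp add: right_diff_distrib sum_subtractf flip: sum_distrib_right)
      also have "\<bar>\<dots>\<bar> \<le> (\<Sum>a\<in>S. \<bar>v a * (P a b - m b)\<bar>)"
        by (rule sum_abs)
      also have "\<dots> = (\<Sum>a\<in>S. \<bar>v a\<bar> * (P a b - m b))"
        using m_le by (intro sum.cong) (auto simp: abs_mult)
      finally show "\<bar>\<Sum>a\<in>S. v a * P a b\<bar> \<le> (\<Sum>a\<in>S. \<bar>v a\<bar> * (P a b - m b))" .
    qed
    also have "\<dots> = (\<Sum>a\<in>S. \<bar>v a\<bar> * ((\<Sum>b\<in>S. P a b) - (\<Sum>b\<in>S. m b)))"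
      by (subst sum.swap) (simp add: sum_subtractf flip: sum_distrib_left)
    also have "\<dots> = (1 - (\<Sum>b\<in>S. m b)) * (\<Sum>a\<in>S. \<bar>v a\<bar>)"
      using P unfolding sum_distrib_left
      by (intro sum.cong) (auto simp: positive_stochastic_def)
    finally show "(\<Sum>b\<in>S. \<bar>\<Sum>a\<in>S. v a * P a b\<bar>) \<le> (1 - (\<Sum>b\<in>S. m b)) * (\<Sum>a\<in>S. \<bar>v a\<bar>)" .
  qed (use le1 gt0 in auto)
qed

section \<open>Power iteration and existence of stationary vectors\<close>

lemma sum_stochastic_step:
  fixes P :: "'a \<Rightarrow> 'a \<Rightarrow> real"
  assumes "positive_stochastic S P"
  shows "(\<Sum>b\<in>S. \<Sum>a\<in>S. v a * P a b) = (\<Sum>a\<in>S. v a)"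
  using assms by (subst sum.swap) (simp add: positive_stochastic_def flip: sum_distrib_left)

text \<open>Successive iterates have equal mass, so their differences contract geometrically and the
  iteration converges. Keeping \<open>K\<close> general lets one argument serve both the simplex
  and, later, the rescaled strategies. Vanishing of \<open>v0\<close> off \<open>S\<close> makes the
  coordinates outside \<open>S\<close> converge as well.\<close>

lemma stationary_in_closed_invariant_set:
  fixes P :: "'a \<Rightarrow> 'a \<Rightarrow> real"
  assumes fin: "finite S" and ne: "S \<noteq> {}" and P: "positive_stochastic S P"
    and v0: "v0 \<in> K" "\<And>b. b \<notin> S \<Longrightarrow> v0 b = 0"
    and step: "\<And>v. v \<in> K \<Longrightarrow> (\<lambda>b. if b \<in> S then \<Sum>a\<in>S. v a * P a b else 0) \<in> K"
    and closed: "\<And>X v. (\<And>n. X n \<in> K) \<Longrightarrow> (\<And>b. (\<lambda>n. X n b) \<longlonglongrightarrow> v b) \<Longrightarrow> v \<in> K"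
  shows "\<exists>v\<in>K. stationary S P v"
proof -
  define F where "F v = (\<lambda>b. if b \<in> S then \<Sum>a\<in>S. v a * P a b else 0)" for v :: "'a \<Rightarrow> real"
  define X where "X n = (F ^^ n) v0" for n
  have X0: "X 0 = v0" and XS: "X (Suc n) = F (X n)" for n
    by (auto simp: X_def)
  have XK: "X n \<in> K" for n
    by (induction n) (auto simp: X0 XS v0 F_def intro: step)
  obtain c where c: "0 \<le> c" "c < 1"
    and contr: "\<And>v. (\<Sum>a\<in>S. v a) = 0 \<Longrightarrow>
      (\<Sum>b\<in>S. \<bar>\<Sum>a\<in>S. v a * P a b\<bar>) \<le> c * (\<Sum>a\<in>S. \<bar>v a\<bar>)"
    using positive_stochastic_contraction[OF fin ne P] by blast
  have massF: "(\<Sum>b\<in>S. F v b) = (\<Sum>a\<in>S. v a)" for v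
    using sum_stochastic_step[OF P] by (simp add: F_def)
  define C where "C = (\<Sum>a\<in>S. \<bar>X 1 a - X 0 a\<bar>)"
  have diff: "(\<Sum>a\<in>S. \<bar>X (Suc n) a - X n a\<bar>) \<le> C * c ^ n" for n
  proof (induction n)
    case 0
    then show ?case by (simp add: C_def)
  next
    case (Suc n)
    have "(\<Sum>a\<in>S. \<bar>X (Suc (Suc n)) a - X (Suc n) a\<bar>)
        = (\<Sum>b\<in>S. \<bar>\<Sum>a\<in>S. (X (Suc n) a - X n a) * P a b\<bar>)"
      unfolding XS[of "Suc n"] XS[of n]
      by (intro sum.cong) (auto simp: F_def left_diff_distrib sum_subtractf)
    also have "\<dots> \<le> c * (\<Sum>a\<in>S. \<bar>X (Suc n) a - X n a\<bar>)"
      by (rule contr) (simp add: sum_subtractf XS massF)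
    also have "\<dots> \<le> c * (C * c ^ n)"
      using Suc c by (intro mult_left_mono) auto
    finally show ?case by (simp add: mult_ac)
  qed
  have "\<exists>L. (\<lambda>n. X n b) \<longlonglongrightarrow> L" for b
  proof -
    have bnd: "norm (X (Suc n) b - X n b) \<le> C * c ^ n" for n
    proof (cases "b \<in> S")
      case True
      have "\<bar>X (Suc n) b - X n b\<bar> \<le> (\<Sum>a\<in>S. \<bar>X (Suc n) a - X n a\<bar>)"
        using fin True by (intro member_le_sum) auto
      with diff[of n] show ?thesis by simp
    next
      case False
      have "X n b = 0" "X (Suc n) b = 0"
        using False by (cases n; simp add: X0 XS F_def v0)+
      moreover have "0 \<le> C" unfolding C_def by (intro sum_nonneg) auto
      ultimately show ?thesis using c by simp
    qed
    have "summable (\<lambda>n. C * c ^ n)"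
      using c by (intro summable_mult summable_geometric) auto
    then have "summable (\<lambda>n. X (Suc n) b - X n b)"
      by (rule summable_comparison_test'[where N = 0]) (use bnd in auto)
    then have "(\<lambda>n. \<Sum>k<n. X (Suc k) b - X k b) \<longlonglongrightarrow> (\<Sum>k. X (Suc k) b - X k b)"
      by (rule summable_LIMSEQ)
    then have "(\<lambda>n. X n b - X 0 b) \<longlonglongrightarrow> (\<Sum>k. X (Suc k) b - X k b)"
      by (simp only: sum_lessThan_telescope[of "\<lambda>k. X k b"])
    then have "(\<lambda>n. (X n b - X 0 b) + X 0 b) \<longlonglongrightarrow> (\<Sum>k. X (Suc k) b - X k b) + X 0 b"
      by (intro tendsto_add tendsto_const)
    then show ?thesis by auto
  qed
  then obtain v where v: "\<And>b. (\<lambda>n. X n b) \<longlonglongrightarrow> v b" by metis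
  have "v b = (\<Sum>a\<in>S. v a * P a b)" if b: "b \<in> S" for b
  proof (rule LIMSEQ_unique)
    show "(\<lambda>n. X (Suc n) b) \<longlonglongrightarrow> v b"
      using v by (rule LIMSEQ_Suc)
    have "(\<lambda>n. \<Sum>a\<in>S. X n a * P a b) \<longlonglongrightarrow> (\<Sum>a\<in>S. v a * P a b)"
      by (intro tendsto_sum tendsto_mult v tendsto_const)
    then show "(\<lambda>n. X (Suc n) b) \<longlonglongrightarrow> (\<Sum>a\<in>S. v a * P a b)"
      using b by (simp add: XS F_def)
  qed
  moreover have "v \<in> K" using XK v by (rule closed)
  ultimately show ?thesis unfolding stationary_def by blast
qed

text \<open>One step of a positive chain turns a nonnegative nonzero vector into a positive one. The
  mass is prescribed because vectors are compared below only at equal mass.\<close>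

lemma positive_stationary_exists:
  fixes P :: "'a \<Rightarrow> 'a \<Rightarrow> real"
  assumes fin: "finite S" and ne: "S \<noteq> {}" and P: "positive_stochastic S P" and M: "0 < M"
  shows "\<exists>v. stationary S P v \<and> (\<forall>b\<in>S. 0 < v b) \<and> (\<Sum>b\<in>S. v b) = M"
proof -
  define K where "K = {v :: 'a \<Rightarrow> real. (\<forall>b. 0 \<le> v b) \<and> (\<Sum>b\<in>S. v b) = M}"
  obtain s where s: "s \<in> S" using ne by blast
  have "\<exists>v\<in>K. stationary S P v"
  proof (rule stationary_in_closed_invariant_set[OF fin ne P])
    show "(\<lambda>b. if b = s then M else 0) \<in> K"
      using fin s M by (auto simp: K_def)
    show "(if b = s then M else 0) = 0" if "b \<notin> S" for b
      using s that by auto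
    show "(\<lambda>b. if b \<in> S then \<Sum>a\<in>S. v a * P a b else 0) \<in> K" if "v \<in> K" for v
      using that P by (auto simp: K_def sum_stochastic_step positive_stochastic_def less_imp_le
          intro!: sum_nonneg mult_nonneg_nonneg)
    show "v \<in> K" if X: "\<And>n. X n \<in> K" "\<And>b. (\<lambda>n. X n b) \<longlonglongrightarrow> v b" for X v
    proof -
      have "0 \<le> v b" for b
        using X by (intro LIMSEQ_le_const[OF X(2)]) (auto simp: K_def)
      moreover have "(\<lambda>n. \<Sum>b\<in>S. X n b) \<longlonglongrightarrow> (\<Sum>b\<in>S. v b)"
        by (intro tendsto_sum X)
      then have "(\<Sum>b\<in>S. v b) = M"
        using X(1) by (auto simp: K_def LIMSEQ_const_iff)
      ultimately show ?thesis by (simp add: K_def)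
    qed
  qed
  then obtain v where v: "\<And>b. 0 \<le> v b" "(\<Sum>b\<in>S. v b) = M" "stationary S P v"
    by (auto simp: K_def)
  obtain a0 where a0: "a0 \<in> S" "v a0 \<noteq> 0"
    using v(2) M by (metis less_irrefl sum.neutral)
  have "0 < v b" if b: "b \<in> S" for b
  proof -
    have "0 < (\<Sum>a\<in>S. v a * P a b)"
      using fin a0 v P b
      by (intro sum_pos2[of _ a0]) (auto simp: positive_stochastic_def less_le)
    also have "\<dots> = v b" by (rule stationaryD[OF v(3) b])
    finally show ?thesis .
  qed
  with v show ?thesis by blast
qed

section \<open>Comparison of stationary vectors when rows are exchanged\<close>

text \<open>Normalised at the modified row \<open>s\<close>, the ratio of the two stationary vectors cannot
  exceed \<open>c\<close>: at a maximiser of the ratio the balance equation would be violated.\<close>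

lemma stationary_row_ratio:
  fixes P P' :: "'a \<Rightarrow> 'a \<Rightarrow> real"
  assumes fin: "finite S" and s: "s \<in> S"
    and P: "positive_stochastic S P"
    and eq: "\<And>a b. a \<in> S \<Longrightarrow> a \<noteq> s \<Longrightarrow> b \<in> S \<Longrightarrow> P' a b = P a b"
    and row: "\<And>b. b \<in> S \<Longrightarrow> P' s b \<le> c * P s b" and c: "1 \<le> c"
    and v: "stationary S P v" "\<And>b. b \<in> S \<Longrightarrow> 0 < v b"
    and v': "stationary S P' v'" "\<And>b. b \<in> S \<Longrightarrow> 0 < v' b"
    and b: "b \<in> S"
  shows "v' b / v' s \<le> c * (v b / v s)"
proof -
  define w where "w b = v b / v s" for b
  define w' where "w' b = v' b / v' s" for b
  have pos: "0 < v s" "0 < v' s" using v v' s by auto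
  have wpos: "0 < w b" if "b \<in> S" for b using v pos that by (simp add: w_def)
  have w_s: "w s = 1" "w' s = 1" using pos by (auto simp: w_def w'_def)
  have w: "w b = P s b + (\<Sum>a\<in>S - {s}. w a * P a b)" if "b \<in> S" for b
  proof -
    have "(\<Sum>a\<in>S. w a * P a b) = w b"
      using stationaryD[OF v(1) that] by (simp add: w_def flip: sum_divide_distrib)
    then show ?thesis
      using sum.remove[OF fin s, of "\<lambda>a. w a * P a b"] w_s by simp
  qed
  have w': "w' b = P' s b + (\<Sum>a\<in>S - {s}. w' a * P a b)" if "b \<in> S" for b
  proof -
    have "(\<Sum>a\<in>S. w' a * P' a b) = w' b"
      using stationaryD[OF v'(1) that] by (simp add: w'_def flip: sum_divide_distrib)
    then have "w' b = P' s b + (\<Sum>a\<in>S - {s}. w' a * P' a b)"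
      using sum.remove[OF fin s, of "\<lambda>a. w' a * P' a b"] w_s by simp
    also have "(\<Sum>a\<in>S - {s}. w' a * P' a b) = (\<Sum>a\<in>S - {s}. w' a * P a b)"
      using eq that by (intro sum.cong) auto
    finally show ?thesis .
  qed
  define M where "M = Max ((\<lambda>b. w' b / w b) ` S)"
  have ne: "S \<noteq> {}" using s by auto
  have M_ge: "w' b \<le> M * w b" if "b \<in> S" for b
  proof -
    have "w' b / w b \<le> M" using fin that by (auto simp: M_def)
    then show ?thesis using wpos[OF that] by (simp add: field_simps)
  qed
  have "M \<in> (\<lambda>b. w' b / w b) ` S" unfolding M_def using fin ne by (intro Max_in) auto
  then obtain t where t: "t \<in> S" "M = w' t / w t" by auto
  have "M \<le> c"
  proof (rule ccontr)
    assume "\<not> M \<le> c"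
    then have Mc: "c < M" by simp
    have Pst: "0 < P s t" using P s t by (auto simp: positive_stochastic_def)
    have "w' t = P' s t + (\<Sum>a\<in>S - {s}. w' a * P a t)" using w' t by blast
    also have "\<dots> \<le> c * P s t + (\<Sum>a\<in>S - {s}. (M * w a) * P a t)"
      using P t by (intro add_mono row sum_mono mult_right_mono M_ge)
        (auto simp: positive_stochastic_def less_imp_le)
    also have "\<dots> < M * P s t + (\<Sum>a\<in>S - {s}. (M * w a) * P a t)"
      using Mc Pst by simp
    also have "\<dots> = M * w t"
      using w[OF t(1)] by (simp add: distrib_left sum_distrib_left mult_ac)
    also have "\<dots> = w' t"
      using t wpos[OF t(1)] by simp
    finally show False by simp
  qed
  then have "w' b \<le> c * w b"
    using M_ge[OF b] wpos[OF b] by (meson less_imp_le mult_right_mono order_trans)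
  then show ?thesis by (simp add: w_def w'_def)
qed

text \<open>The ratio bound compares vectors normalised at \<open>s\<close>, and costs one factor
  \<open>c\<close>. The second factor undoes the normalisation: summing the reverse ratio bound over
  \<open>S\<close>, with equal masses, gives \<open>v' s \<le> c * v s\<close>.\<close>

lemma stationary_row_perturbation:
  fixes P P' :: "'a \<Rightarrow> 'a \<Rightarrow> real"
  assumes fin: "finite S" and s: "s \<in> S"
    and P: "positive_stochastic S P" and P': "positive_stochastic S P'"
    and eq: "\<And>a b. a \<in> S \<Longrightarrow> a \<noteq> s \<Longrightarrow> b \<in> S \<Longrightarrow> P' a b = P a b"
    and row: "\<And>b. b \<in> S \<Longrightarrow> P' s b \<le> c * P s b" "\<And>b. b \<in> S \<Longrightarrow> P s b \<le> c * P' s b"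
    and c: "1 \<le> c"
    and v: "stationary S P v" "\<And>b. b \<in> S \<Longrightarrow> 0 < v b"
    and v': "stationary S P' v'" "\<And>b. b \<in> S \<Longrightarrow> 0 < v' b"
    and mass: "(\<Sum>b\<in>S. v' b) = (\<Sum>b\<in>S. v b)"
    and b: "b \<in> S"
  shows "v' b \<le> c\<^sup>2 * v b"
proof -
  have pos: "0 < v s" "0 < v' s" using v v' s by auto
  have 1: "v' b / v' s \<le> c * (v b / v s)" if "b \<in> S" for b
    using stationary_row_ratio[OF fin s P eq row(1) c v v' that] by blast
  have 2: "v b / v s \<le> c * (v' b / v' s)" if "b \<in> S" for b
    using stationary_row_ratio[OF fin s P' _ row(2) c v' v that] eq by simp
  have m: "0 < (\<Sum>b\<in>S. v b)" using fin s v by (intro sum_pos) auto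
  have "(\<Sum>b\<in>S. v b / v s) \<le> (\<Sum>b\<in>S. c * (v' b / v' s))"
    by (intro sum_mono 2)
  then have "(\<Sum>b\<in>S. v b) / v s \<le> c * ((\<Sum>b\<in>S. v b) / v' s)"
    by (simp add: mass sum_divide_distrib[symmetric] sum_distrib_left[symmetric])
  then have s_le: "v' s \<le> c * v s"
    using m pos by (simp add: field_simps)
  have "v' b = v' s * (v' b / v' s)" using pos by simp
  also have "\<dots> \<le> (c * v s) * (c * (v b / v s))"
    using s_le 1[OF b] pos c v'(2)[OF b] by (intro mult_mono) auto
  also have "\<dots> = c\<^sup>2 * v b" using pos by (simp add: power2_eq_square)
  finally show ?thesis .
qed

text \<open>A hybrid argument. Exchanging whole rows keeps each hybrid \<open>H F\<close> positive
  and stochastic, so it has a positive stationary vector of mass \<open>M\<close> through which the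
  comparison can pass, at a factor \<open>c^2\<close> per row.\<close>

theorem stationary_perturbation:
  fixes P P' :: "'a \<Rightarrow> 'a \<Rightarrow> real"
  assumes fin: "finite S"
    and P: "positive_stochastic S P" and P': "positive_stochastic S P'"
    and le: "\<And>a b. a \<in> S \<Longrightarrow> b \<in> S \<Longrightarrow> P' a b \<le> c * P a b"
      "\<And>a b. a \<in> S \<Longrightarrow> b \<in> S \<Longrightarrow> P a b \<le> c * P' a b"
    and c: "1 \<le> c"
    and v: "stationary S P v" "\<And>b. b \<in> S \<Longrightarrow> 0 < v b"
    and v': "stationary S P' v'" "\<And>b. b \<in> S \<Longrightarrow> 0 < v' b"
    and mass: "(\<Sum>b\<in>S. v' b) = (\<Sum>b\<in>S. v b)"
    and b: "b \<in> S"
  shows "v' b \<le> c ^ (2 * card S) * v b"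
proof -
  have ne: "S \<noteq> {}" using b by auto
  define M where "M = (\<Sum>b\<in>S. v b)"
  have M: "0 < M" unfolding M_def using fin ne v by (intro sum_pos) auto
  define H where "H F a = (if a \<in> F then P' a else P a)" for F a
  have H: "positive_stochastic S (H F)" for F
    using P P' by (auto simp: positive_stochastic_def H_def)
  have main: "finite F \<Longrightarrow> F \<subseteq> S \<Longrightarrow>
      \<forall>u. stationary S (H F) u \<and> (\<forall>b\<in>S. 0 < u b) \<and> (\<Sum>b\<in>S. u b) = M \<longrightarrow>
        (\<forall>b\<in>S. u b \<le> c ^ (2 * card F) * v b)" for F
  proof (induction F rule: finite_induct)
    case empty
    have H0: "H {} = P" by (auto simp: H_def)
    show ?case
    proof (intro allI impI ballI, elim conjE)
      fix u b
      assume u: "stationary S (H {}) u" "\<forall>b\<in>S. 0 < u b" "(\<Sum>b\<in>S. u b) = M" and b: "b \<in> S"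
      \<comment> \<open>With \<open>c = 1\<close> and equal kernels the row lemma amounts to
        uniqueness of the stationary vector of given mass.\<close>
      have "u b \<le> 1\<^sup>2 * v b"
        by (rule stationary_row_perturbation[OF fin b P P]) (use u v b in \<open>auto simp: H0 M_def\<close>)
      then show "u b \<le> c ^ (2 * card {}) * v b" by simp
    qed
  next
    case (insert s F)
    obtain u0 where u0: "stationary S (H F) u0" "\<forall>b\<in>S. 0 < u0 b" "(\<Sum>b\<in>S. u0 b) = M"
      using positive_stationary_exists[OF fin ne H M] by blast
    show ?case
    proof (intro allI impI ballI, elim conjE)
      fix u b
      assume u: "stationary S (H (insert s F)) u" "\<forall>b\<in>S. 0 < u b" "(\<Sum>b\<in>S. u b) = M"
        and b: "b \<in> S"
      have "u b \<le> c\<^sup>2 * u0 b"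
        by (rule stationary_row_perturbation[OF fin _ H[of F] H[of "insert s F"], where s = s])
          (use insert u u0 b c le in \<open>auto simp: H_def\<close>)
      also have "\<dots> \<le> c\<^sup>2 * (c ^ (2 * card F) * v b)"
        using insert u0 b by (intro mult_left_mono) auto
      also have "\<dots> = c ^ (2 * card (insert s F)) * v b"
        using insert by (simp add: power2_eq_square)
      finally show "u b \<le> c ^ (2 * card (insert s F)) * v b" .
    qed
  qed
  have "stationary S (H S) v'"
    using stationaryD[OF v'(1)] by (simp add: stationary_def H_def)
  then show ?thesis using main[OF fin] v' mass b M_def by auto
qed

section \<open>Optimistic exponential weights\<close>

definition softmax :: "'i set \<Rightarrow> real \<Rightarrow> ('i \<Rightarrow> real) \<Rightarrow> 'i \<Rightarrow> real" where
  "softmax I e w i = exp (e * w i) / (\<Sum>k\<in>I. exp (e * w k))"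

section \<open>Softmax weights and their sensitivity to the scores\<close>

lemma sum_exp_pos: "finite I \<Longrightarrow> I \<noteq> {} \<Longrightarrow> 0 < (\<Sum>k\<in>I. exp (f k :: real))"
  by (intro sum_pos) auto

lemma softmax_pos: "finite I \<Longrightarrow> I \<noteq> {} \<Longrightarrow> 0 < softmax I e w i"
  by (simp add: softmax_def sum_exp_pos)

lemma sum_softmax: "finite I \<Longrightarrow> I \<noteq> {} \<Longrightarrow> (\<Sum>i\<in>I. softmax I e w i) = 1"
  using sum_exp_pos[of I "\<lambda>k. e * w k"] by (simp add: softmax_def flip: sum_divide_distrib)

text \<open>The numerator and the normalising sum each move by a factor of at most
  \<open>exp (e * d)\<close>; hence the 2.\<close>

lemma softmax_perturbation:
  assumes fin: "finite I" and ne: "I \<noteq> {}" and e: "0 \<le> e" and i: "i \<in> I"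
    and d: "\<And>k. k \<in> I \<Longrightarrow> \<bar>w k - w' k\<bar> \<le> d"
  shows "softmax I e w i \<le> exp (2 * e * d) * softmax I e w' i"
proof -
  have le: "exp (e * w k) \<le> exp (e * d) * exp (e * w' k)"
    and ge: "exp (e * w' k) \<le> exp (e * d) * exp (e * w k)" if "k \<in> I" for k
  proof -
    have "e * w k \<le> e * (d + w' k)" "e * w' k \<le> e * (d + w k)"
      using d[OF that] e by (auto intro!: mult_left_mono)
    then show "exp (e * w k) \<le> exp (e * d) * exp (e * w' k)"
      "exp (e * w' k) \<le> exp (e * d) * exp (e * w k)"
      by (simp_all add: distrib_left flip: exp_add)
  qed
  let ?Z = "\<Sum>k\<in>I. exp (e * w k)" and ?Z' = "\<Sum>k\<in>I. exp (e * w' k)"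
  have Z: "0 < ?Z" "0 < ?Z'" using fin ne by (auto intro: sum_exp_pos)
  have "?Z' \<le> exp (e * d) * ?Z"
    unfolding sum_distrib_left by (intro sum_mono ge)
  then have "1 / ?Z \<le> exp (e * d) / ?Z'"
    using Z by (simp add: field_simps)
  then have "exp (e * w i) * (1 / ?Z) \<le> (exp (e * d) * exp (e * w' i)) * (exp (e * d) / ?Z')"
    using le[OF i] Z by (intro mult_mono) auto
  also have "\<dots> = exp (2 * e * d) * softmax I e w' i"
    by (simp add: softmax_def field_simps flip: exp_add)
  finally show ?thesis by (simp add: softmax_def)
qed

text \<open>Averaged over a variable of mean 0 the linear term drops out, which leaves a
  sub-Gaussian bound that requires no smallness of \<open>z\<close>.\<close>

lemma exp_le_add_exp_square: "exp z \<le> z + exp (z\<^sup>2)" for z :: real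
proof -
  consider "1 < z" | "0 \<le> z" "z \<le> 1" | "z < 0" by linarith
  then show ?thesis
  proof cases
    case 1
    then have "exp z \<le> exp (z\<^sup>2)" by (simp add: power2_eq_square)
    with 1 show ?thesis by linarith
  next
    case 2
    then have "exp z \<le> 1 + z + z\<^sup>2" by (rule exp_bound)
    moreover have "1 + z\<^sup>2 \<le> exp (z\<^sup>2)" by (rule exp_ge_add_one_self)
    ultimately show ?thesis by linarith
  next
    case 3
    define y where "y = - z"
    have y: "0 < y" using 3 by (simp add: y_def)
    have "1 + y + y\<^sup>2 / 2 \<le> exp y"
      using exp_lower_Taylor_quadratic[of y] y by simp
    then have "exp (- y) \<le> 1 / (1 + y + y\<^sup>2 / 2)"
      using y by (simp add: exp_minus field_simps add_pos_pos)
    also have "\<dots> \<le> 1 - y + y\<^sup>2"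
    proof -
      \<comment> \<open>Multiplying out leaves 1 plus nonnegative terms, so
        \<open>1 - y + y^2\<close> dominates the reciprocal.\<close>
      have "(1 - y + y\<^sup>2) * (1 + y + y\<^sup>2 / 2) = 1 + y\<^sup>2 / 2 + y^3 / 2 + y^4 / 2"
        by (simp add: power2_eq_square power3_eq_cube power4_eq_xxxx field_simps)
      also have "\<dots> \<ge> 1" using y by simp
      finally show ?thesis using y
        by (subst pos_divide_le_eq) (auto intro!: add_pos_nonneg)
    qed
    also have "1 - y + y\<^sup>2 \<le> z + exp (z\<^sup>2)"
      using exp_ge_add_one_self[of "z\<^sup>2"] by (simp add: y_def)
    finally show ?thesis by (simp add: y_def)
  qed
qed

section \<open>Bounds on the logarithm of an exponential mean\<close>

context
  fixes I :: "'i set" and x :: "'i \<Rightarrow> real"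
  assumes fin: "finite I" and x: "\<And>i. i \<in> I \<Longrightarrow> 0 < x i" "(\<Sum>i\<in>I. x i) = 1"
begin

lemma index_nonempty: "I \<noteq> {}"
  using x(2) by auto

text \<open>Jensen's inequality, by the tangent of \<open>exp\<close> at the mean.\<close>

lemma mean_le_ln_mean_exp: "(\<Sum>i\<in>I. x i * y i) \<le> ln (\<Sum>i\<in>I. x i * exp (y i))"
proof -
  define m where "m = (\<Sum>i\<in>I. x i * y i)"
  have "(\<Sum>i\<in>I. x i * (1 + (y i - m))) = 1 + m - m * (\<Sum>i\<in>I. x i)"
  proof -
    have "(\<Sum>i\<in>I. x i * (1 + (y i - m))) = (\<Sum>i\<in>I. x i) + (\<Sum>i\<in>I. x i * y i) - (\<Sum>i\<in>I. m * x i)"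
      by (simp add: algebra_simps sum.distrib sum_subtractf)
    then show ?thesis by (simp add: x(2) flip: m_def sum_distrib_left)
  qed
  then have "1 = (\<Sum>i\<in>I. x i * (1 + (y i - m)))" by (simp add: x(2))
  also have "\<dots> \<le> (\<Sum>i\<in>I. x i * exp (y i - m))"
    using x(1) by (intro sum_mono mult_left_mono exp_ge_add_one_self) (auto simp: less_imp_le)
  also have "\<dots> = (\<Sum>i\<in>I. x i * exp (y i)) / exp m"
    by (simp add: exp_diff sum_divide_distrib)
  finally have "exp m \<le> (\<Sum>i\<in>I. x i * exp (y i))" by (simp add: field_simps)
  then have "ln (exp m) \<le> ln (\<Sum>i\<in>I. x i * exp (y i))"
    by (intro ln_mono) auto
  then show ?thesis by (simp add: m_def)
qed

text \<open>The values and their mean lie in \<open>[-d, d]\<close>, so the centred values are at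
  most \<open>2 * d\<close> in absolute value; squaring gives the constant 4.\<close>

lemma ln_mean_exp_le:
  assumes y: "\<And>i. i \<in> I \<Longrightarrow> \<bar>y i\<bar> \<le> d"
  shows "ln (\<Sum>i\<in>I. x i * exp (y i)) \<le> (\<Sum>i\<in>I. x i * y i) + 4 * d\<^sup>2"
proof -
  define m where "m = (\<Sum>i\<in>I. x i * y i)"
  have "\<bar>m\<bar> \<le> (\<Sum>i\<in>I. \<bar>x i * y i\<bar>)" unfolding m_def by (rule sum_abs)
  also have "\<dots> \<le> (\<Sum>i\<in>I. x i * d)"
    using x(1) y by (intro sum_mono) (auto simp: abs_mult less_imp_le intro!: mult_mono)
  also have "\<dots> = d" by (simp add: x(2) flip: sum_distrib_right)
  finally have m: "\<bar>m\<bar> \<le> d" .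
  have sq: "(y i - m)\<^sup>2 \<le> 4 * d\<^sup>2" if "i \<in> I" for i
  proof -
    have "\<bar>y i - m\<bar> \<le> \<bar>2 * d\<bar>" using y[OF that] m by linarith
    then have "(y i - m)\<^sup>2 \<le> (2 * d)\<^sup>2" by (simp add: abs_le_square_iff)
    then show ?thesis by (simp add: power_mult_distrib)
  qed
  have "(\<Sum>i\<in>I. x i * exp (y i)) / exp m = (\<Sum>i\<in>I. x i * exp (y i - m))"
    by (simp add: exp_diff sum_divide_distrib)
  also have "\<dots> \<le> (\<Sum>i\<in>I. x i * ((y i - m) + exp (4 * d\<^sup>2)))"
  proof (intro sum_mono mult_left_mono)
    fix i assume i: "i \<in> I"
    have "exp (y i - m) \<le> (y i - m) + exp ((y i - m)\<^sup>2)" by (rule exp_le_add_exp_square)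
    with sq[OF i] show "exp (y i - m) \<le> (y i - m) + exp (4 * d\<^sup>2)"
      by (smt (verit) exp_le_cancel_iff)
  qed (use x in \<open>auto simp: less_imp_le\<close>)
  also have "\<dots> = m - m * (\<Sum>i\<in>I. x i) + exp (4 * d\<^sup>2) * (\<Sum>i\<in>I. x i)"
  proof -
    have "(\<Sum>i\<in>I. x i * ((y i - m) + exp (4 * d\<^sup>2)))
        = (\<Sum>i\<in>I. x i * y i) - (\<Sum>i\<in>I. m * x i) + (\<Sum>i\<in>I. exp (4 * d\<^sup>2) * x i)"
      by (simp add: algebra_simps sum.distrib sum_subtractf)
    then show ?thesis by (simp flip: m_def sum_distrib_left)
  qed
  finally have "(\<Sum>i\<in>I. x i * exp (y i)) \<le> exp (m + 4 * d\<^sup>2)"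
    by (simp add: x(2) exp_add field_simps)
  moreover have "0 < (\<Sum>i\<in>I. x i * exp (y i))"
    using fin index_nonempty x by (intro sum_pos) auto
  ultimately have "ln (\<Sum>i\<in>I. x i * exp (y i)) \<le> ln (exp (m + 4 * d\<^sup>2))"
    by (intro ln_mono) auto
  then show ?thesis by (simp add: m_def)
qed

end

text \<open>With the potential \<open>F L = ln (\<Sum>i. exp (e * L i))\<close>, whose gradient at \<open>L + m\<close> is
  \<open>e * softmax I e (L + m)\<close>, convexity compares \<open>F L\<close> with \<open>F (L + m)\<close> and smoothness compares
  \<open>F (L + U)\<close> with \<open>F (L + m)\<close>; only the prediction error \<open>U - m\<close> is paid for.\<close>

lemma softmax_potential_step:
  fixes L m U :: "'i \<Rightarrow> real"
  assumes fin: "finite I" and ne: "I \<noteq> {}" and e: "0 < e"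
    and d: "\<And>i. i \<in> I \<Longrightarrow> \<bar>U i - m i\<bar> \<le> d"
  shows "ln (\<Sum>i\<in>I. exp (e * (L i + U i))) - ln (\<Sum>i\<in>I. exp (e * L i))
    \<le> e * (\<Sum>i\<in>I. softmax I e (\<lambda>i. L i + m i) i * U i) + 4 * (e * d)\<^sup>2"
proof -
  define x where "x = softmax I e (\<lambda>i. L i + m i)"
  have x: "\<And>i. i \<in> I \<Longrightarrow> 0 < x i" "(\<Sum>i\<in>I. x i) = 1"
    using fin ne by (auto simp: x_def softmax_pos sum_softmax)
  define Z where "Z = (\<Sum>i\<in>I. exp (e * (L i + m i)))"
  have Z: "0 < Z" unfolding Z_def using fin ne by (rule sum_exp_pos)
  \<comment> \<open>A change of measure to the weights \<open>x\<close> in use. With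
    \<open>V = U\<close> it expresses the new potential, with \<open>V = 0\<close> the old one, and
    \<open>ln Z\<close> cancels in the difference.\<close>
  have shift: "ln (\<Sum>i\<in>I. exp (e * (L i + V i)))
      = ln Z + ln (\<Sum>i\<in>I. x i * exp (e * (V i - m i)))" for V
  proof -
    have "(\<Sum>i\<in>I. exp (e * (L i + V i))) = Z * (\<Sum>i\<in>I. x i * exp (e * (V i - m i)))"
      unfolding sum_distrib_left
    proof (intro sum.cong refl)
      fix i
      have "Z * x i = exp (e * (L i + m i))"
        using Z by (simp add: x_def softmax_def flip: Z_def)
      then have "Z * (x i * exp (e * (V i - m i))) = exp (e * (L i + m i)) * exp (e * (V i - m i))"
        by (simp add: mult.assoc[symmetric])
      then show "exp (e * (L i + V i)) = Z * (x i * exp (e * (V i - m i)))"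
        by (simp add: algebra_simps flip: exp_add)
    qed
    moreover have "0 < (\<Sum>i\<in>I. x i * exp (e * (V i - m i)))"
      using fin ne x by (intro sum_pos) auto
    ultimately show ?thesis using Z by (simp add: ln_mult)
  qed
  have "ln (\<Sum>i\<in>I. x i * exp (e * (U i - m i)))
      \<le> (\<Sum>i\<in>I. x i * (e * (U i - m i))) + 4 * (e * d)\<^sup>2"
    using d e by (intro ln_mean_exp_le fin x) (auto simp: abs_mult)
  moreover have "(\<Sum>i\<in>I. x i * (e * (0 - m i))) \<le> ln (\<Sum>i\<in>I. x i * exp (e * (0 - m i)))"
    by (intro mean_le_ln_mean_exp fin x)
  moreover have "(\<Sum>i\<in>I. x i * (e * (U i - m i))) - (\<Sum>i\<in>I. x i * (e * (0 - m i)))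
      = e * (\<Sum>i\<in>I. x i * U i)"
    by (simp add: algebra_simps sum_subtractf sum_negf sum_distrib_left)
  ultimately show ?thesis
    using shift[of U] shift[of "\<lambda>_. 0"] by (simp add: x_def)
qed

text \<open>The potential telescopes: it starts at \<open>ln (card I)\<close> and ends no lower than
  \<open>e\<close> times the total utility of \<open>k\<close>.\<close>

theorem optimistic_softmax_regret:
  fixes L m U :: "nat \<Rightarrow> 'i \<Rightarrow> real"
  assumes fin: "finite I" and e: "0 < e" and k: "k \<in> I"
    and L: "\<And>i. L 0 i = 0" "\<And>t i. L (Suc t) i = L t i + U t i"
    and d: "\<And>t i. t < T \<Longrightarrow> i \<in> I \<Longrightarrow> \<bar>U t i - m t i\<bar> \<le> d t"
  shows "(\<Sum>t<T. U t k) - (\<Sum>t<T. \<Sum>i\<in>I. softmax I e (\<lambda>i. L t i + m t i) i * U t i)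
    \<le> ln (card I) / e + 4 * e * (\<Sum>t<T. (d t)\<^sup>2)"
proof -
  have ne: "I \<noteq> {}" using k by auto
  define F where "F t = ln (\<Sum>i\<in>I. exp (e * L t i))" for t
  let ?G = "\<lambda>t. \<Sum>i\<in>I. softmax I e (\<lambda>i. L t i + m t i) i * U t i"
  have "F T - F 0 = (\<Sum>t<T. F (Suc t) - F t)"
    by (simp only: sum_lessThan_telescope[of F])
  also have "\<dots> \<le> (\<Sum>t<T. e * ?G t + 4 * (e * d t)\<^sup>2)"
    unfolding F_def L using d by (intro sum_mono softmax_potential_step fin ne e) auto
  also have "\<dots> = e * (\<Sum>t<T. ?G t) + 4 * e\<^sup>2 * (\<Sum>t<T. (d t)\<^sup>2)"
    by (simp add: sum.distrib sum_distrib_left power_mult_distrib mult_ac)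
  finally have 1: "F T - F 0 \<le> e * (\<Sum>t<T. ?G t) + 4 * e\<^sup>2 * (\<Sum>t<T. (d t)\<^sup>2)" .
  have F0: "F 0 = ln (card I)" by (simp add: F_def L)
  have LT: "L T k = (\<Sum>t<T. U t k)" by (induction T) (auto simp: L)
  have "exp (e * L T k) \<le> (\<Sum>i\<in>I. exp (e * L T i))"
    using fin k by (intro member_le_sum) auto
  then have "ln (exp (e * L T k)) \<le> F T" unfolding F_def by (intro ln_mono) auto
  then have "e * (\<Sum>t<T. U t k) \<le> F T" by (simp add: LT)
  with 1 F0 have "e * ((\<Sum>t<T. U t k) - (\<Sum>t<T. ?G t))
      \<le> e * (ln (card I) / e + 4 * e * (\<Sum>t<T. (d t)\<^sup>2))"
    using e by (simp add: algebra_simps power2_eq_square)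
  then show ?thesis using e by simp
qed

section \<open>Sequences of a decision tree with perfect recall\<close>

text \<open>A sequence is replaced by the list of all own moves up to it, so that the order of the
  tree becomes the prefix order on lists.\<close>

fun seq_trail :: "(nat \<Rightarrow> (nat \<times> nat) list) \<Rightarrow> sequence \<Rightarrow> (nat \<times> nat) list" where
  "seq_trail h None = []"
| "seq_trail h (Some (j, a)) = h j @ [(j, a)]"

text \<open>Here \<open>h j\<close> stands for the player's own history at \<open>j\<close>, which
  perfect recall makes well defined. The locale isolates the consequences for the decision tree, so
  that the algorithm can be built without reference to the game.\<close>

locale recall_tree =
  fixes D :: decision_tree and h :: "nat \<Rightarrow> (nat \<times> nat) list"
  assumes finite_infosets: "finite (infosets D)"
    and finite_actions: "j \<in> infosets D \<Longrightarrow> finite (actions D j)"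
    and actions_nonempty: "j \<in> infosets D \<Longrightarrow> actions D j \<noteq> {}"
    and parent_eq: "j \<in> infosets D \<Longrightarrow>
      parent D j = (if h j = [] then None else Some (last (h j)))"
    and history_prefix: "j \<in> infosets D \<Longrightarrow> prefix (xs @ [(j', a')]) (h j) \<Longrightarrow>
      j' \<in> infosets D \<and> a' \<in> actions D j' \<and> h j' = xs"
    and precedes_iff: "precedes D j j' \<longleftrightarrow>
      j \<in> infosets D \<and> j' \<in> infosets D \<and> (\<exists>a. (j, a) \<in> set (h j'))"
begin

abbreviation "trail \<equiv> seq_trail h"
abbreviation "S \<equiv> sequences D"
abbreviation "J \<equiv> infosets D"

definition below :: "sequence \<Rightarrow> sequence set" where
  "below s = {t \<in> S. prefix (trail s) (trail t)}"

definition children :: "sequence \<Rightarrow> nat set" where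
  "children s = {j \<in> J. parent D j = s}"

definition flow_at :: "strategy \<Rightarrow> nat \<Rightarrow> bool" where
  "flow_at g j \<longleftrightarrow> g (parent D j) = (\<Sum>a\<in>actions D j. g (Some (j, a)))"

section \<open>Trails and the prefix order on sequences\<close>

lemma Some_in_sequences [simp]: "Some (j, a) \<in> S \<longleftrightarrow> j \<in> J \<and> a \<in> actions D j"
  by (auto simp: sequences_def)

lemma None_in_sequences [simp]: "None \<in> S"
  by (auto simp: sequences_def)

lemma finite_sequences: "finite S"
proof -
  have "S = insert None (Some ` (SIGMA j:J. actions D j))"
    by (auto simp: sequences_def)
  then show ?thesis by (simp add: finite_infosets finite_actions)
qed

lemma trail_inject: "trail s = trail t \<longleftrightarrow> s = t"
  by (cases s; cases t) auto

lemma sequence_prefix: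
  assumes s: "s \<in> S" and p: "prefix (xs @ [(j, a)]) (trail s)"
  shows "j \<in> J" "a \<in> actions D j" "h j = xs"
proof -
  obtain j' a' where s': "s = Some (j', a')" using p by (cases s) auto
  have "j \<in> J \<and> a \<in> actions D j \<and> h j = xs"
    using p s history_prefix[of j' xs j a] unfolding s' by (auto simp: prefix_snoc)
  then show "j \<in> J" "a \<in> actions D j" "h j = xs" by auto
qed

lemma mem_trail_prefix:
  assumes s: "s \<in> S" and m: "(j, a) \<in> set (trail s)"
  shows "Some (j, a) \<in> S" "prefix (trail (Some (j, a))) (trail s)"
proof -
  obtain xs ys where p: "trail s = xs @ (j, a) # ys" using m by (meson split_list)
  then have pre: "prefix (xs @ [(j, a)]) (trail s)" by (simp add: prefix_def)
  show "Some (j, a) \<in> S" "prefix (trail (Some (j, a))) (trail s)"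
    using sequence_prefix[OF s pre] pre by auto
qed

lemma prefix_mem_trail: "prefix (trail (Some (j, a))) (trail s) \<Longrightarrow> (j, a) \<in> set (trail s)"
  by (auto dest!: set_mono_prefix)

text \<open>An entry with information set \<open>j\<close> can only stand at position
  \<open>length (h j)\<close> of a trail.\<close>

lemma trail_action_unique:
  assumes "s \<in> S" "(j, a) \<in> set (trail s)" "(j, a') \<in> set (trail s)"
  shows "a = a'"
proof -
  have "prefix (h j @ [(j, a)]) (trail s)" "prefix (h j @ [(j, a')]) (trail s)"
    using mem_trail_prefix[OF assms(1)] assms(2,3) by auto
  then have "h j @ [(j, a)] = h j @ [(j, a')]"
    by (metis length_append_singleton prefix_length_prefix prefix_order.antisym le_refl)
  then show ?thesis by simp
qed

lemma parent_in_sequences: "j \<in> J \<Longrightarrow> parent D j \<in> S"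
  and trail_parent: "j \<in> J \<Longrightarrow> trail (parent D j) = h j"
proof -
  assume j: "j \<in> J"
  have "parent D j \<in> S \<and> trail (parent D j) = h j"
  proof (cases "h j" rule: rev_cases)
    case Nil
    then show ?thesis using j by (simp add: parent_eq)
  next
    case (snoc xs p)
    then show ?thesis using j history_prefix[of j xs "fst p" "snd p"]
      by (cases p) (auto simp: parent_eq)
  qed
  then show "parent D j \<in> S" "trail (parent D j) = h j" by auto
qed

section \<open>Subtrees of sequences and sums over them\<close>

lemma below_subset: "below s \<subseteq> S"
  by (auto simp: below_def)

lemma finite_below: "finite (below s)"
  using below_subset finite_sequences finite_subset by blast

lemma below_self: "s \<in> S \<Longrightarrow> s \<in> below s"
  by (auto simp: below_def)

lemma below_trans: "t \<in> below s \<Longrightarrow> below t \<subseteq> below s"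
  by (auto simp: below_def intro: prefix_order.trans)

lemma below_None: "below None = S"
  by (auto simp: below_def)

lemma child_below_iff:
  assumes j: "j \<in> J" "a \<in> actions D j"
  shows "Some (j, a) \<in> below s \<longleftrightarrow> s = Some (j, a) \<or> parent D j \<in> below s"
proof -
  have "prefix (trail s) (trail (Some (j, a))) \<longleftrightarrow>
      trail s = trail (Some (j, a)) \<or> prefix (trail s) (trail (parent D j))"
    using j by (simp add: trail_parent prefix_snoc)
  then show ?thesis
    using j parent_in_sequences by (simp only: trail_inject) (auto simp: below_def)
qed

text \<open>The bridge between the order given by \<open>precedes\<close> and the prefix order on
  trails.\<close>

lemma mem_sequences_from:
  assumes j: "j \<in> J"
  shows "t \<in> sequences_from D j \<longleftrightarrow> (\<exists>a\<in>actions D j. t \<in> below (Some (j, a)))"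
proof
  assume "t \<in> sequences_from D j"
  then obtain j' a' where t: "t \<in> S" "t = Some (j', a')" "j' = j \<or> precedes D j j'"
    by (auto simp: sequences_from_def seq_at_or_below_def)
  then obtain a where "(j, a) \<in> set (trail t)" by (auto simp: precedes_iff)
  then have "Some (j, a) \<in> S" "prefix (trail (Some (j, a))) (trail t)"
    using mem_trail_prefix t(1) by blast+
  then show "\<exists>a\<in>actions D j. t \<in> below (Some (j, a))"
    using t(1) by (auto simp: below_def)
next
  assume "\<exists>a\<in>actions D j. t \<in> below (Some (j, a))"
  then obtain a where a: "a \<in> actions D j" "t \<in> S" "(j, a) \<in> set (trail t)"
    by (auto simp: below_def dest: set_mono_prefix)
  then obtain j' a' where t: "t = Some (j', a')" by (cases t) auto
  have "j' = j \<or> precedes D j j'" using a t j by (auto simp: precedes_iff)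
  then show "t \<in> sequences_from D j"
    using a t by (auto simp: sequences_from_def seq_at_or_below_def)
qed

lemma sequences_from_eq: "j \<in> J \<Longrightarrow> sequences_from D j = (\<Union>a\<in>actions D j. below (Some (j, a)))"
  using mem_sequences_from by blast

lemma sequences_from_subset: "sequences_from D j \<subseteq> S"
  by (auto simp: sequences_from_def)

lemma parent_notin_sequences_from:
  assumes j: "j \<in> J" shows "parent D j \<notin> sequences_from D j"
proof
  assume "parent D j \<in> sequences_from D j"
  then obtain a where "parent D j \<in> below (Some (j, a))" using mem_sequences_from j by blast
  then have "prefix (h j @ [(j, a)]) (h j)" using j by (simp add: below_def trail_parent)
  then show False by (auto dest: prefix_length_le)
qed

lemma sum_sequences_from:
  assumes j: "j \<in> J"
  shows "sum f (sequences_from D j) = (\<Sum>a\<in>actions D j. sum f (below (Some (j, a))))"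
  unfolding sequences_from_eq[OF j]
proof (rule sum.UNION_disjoint)
  show "\<forall>a\<in>actions D j. \<forall>a'\<in>actions D j. a \<noteq> a' \<longrightarrow>
      below (Some (j, a)) \<inter> below (Some (j, a')) = {}"
  proof (intro ballI impI, rule ccontr)
    fix a a' assume "a \<noteq> a'" "below (Some (j, a)) \<inter> below (Some (j, a')) \<noteq> {}"
    then show False
      unfolding below_def using trail_action_unique prefix_mem_trail by blast
  qed
qed (use j finite_actions finite_below in auto)

text \<open>The entry that follows \<open>trail s\<close> in a longer trail names the child
  information set and the action through which it passes.\<close>

lemma below_decomposition:
  assumes s: "s \<in> S"
  shows "below s = insert s (\<Union>j\<in>children s. sequences_from D j)"
proof (intro equalityI subsetI)
  fix t assume t: "t \<in> below s"
  then obtain zs where zs: "trail t = trail s @ zs" "t \<in> S" by (auto simp: below_def prefix_def)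
  show "t \<in> insert s (\<Union>j\<in>children s. sequences_from D j)"
  proof (cases zs)
    case Nil
    then show ?thesis using zs trail_inject by auto
  next
    case (Cons p ys)
    obtain j a where p: "p = (j, a)" by (cases p)
    have pre: "prefix (trail s @ [(j, a)]) (trail t)" using zs Cons p by (simp add: prefix_def)
    note ja = sequence_prefix[OF zs(2) pre]
    have "parent D j = s" using ja trail_parent trail_inject by metis
    then have "j \<in> children s" using ja by (auto simp: children_def)
    moreover have "t \<in> sequences_from D j"
      using ja pre zs(2) mem_sequences_from by (auto simp: below_def)
    ultimately show ?thesis by blast
  qed
next
  fix t assume "t \<in> insert s (\<Union>j\<in>children s. sequences_from D j)"
  then consider "t = s" | j a where "j \<in> children s" "a \<in> actions D j" "t \<in> below (Some (j, a))"
    using mem_sequences_from by (auto simp: children_def)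
  then show "t \<in> below s"
  proof cases
    case 1
    then show ?thesis using s below_self by blast
  next
    case 2
    then have "Some (j, a) \<in> below s"
      using child_below_iff below_self s by (auto simp: children_def)
    then show ?thesis using 2 below_trans by blast
  qed
qed

lemma finite_children: "finite (children s)"
  using finite_infosets by (simp add: children_def)

lemma sum_below:
  assumes s: "s \<in> S"
  shows "sum f (below s) = f s + (\<Sum>j\<in>children s. sum f (sequences_from D j))"
proof -
  have disj: "sequences_from D j \<inter> sequences_from D j' = {}"
    if "j \<in> children s" "j' \<in> children s" "j \<noteq> j'" for j j'
  proof (rule ccontr)
    assume "sequences_from D j \<inter> sequences_from D j' \<noteq> {}"
    then obtain t where t: "t \<in> sequences_from D j" "t \<in> sequences_from D j'" by blast
    have "j \<in> J" "j' \<in> J" using that by (auto simp: children_def)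
    then obtain a a' where "t \<in> below (Some (j, a))" "t \<in> below (Some (j', a'))"
      using t mem_sequences_from by metis
    then have "prefix (trail s @ [(j, a)]) (trail t)" "prefix (trail s @ [(j', a')]) (trail t)"
      using that trail_parent[of j] trail_parent[of j'] by (auto simp: below_def children_def)
    then have "trail s @ [(j, a)] = trail s @ [(j', a')]"
      by (metis length_append_singleton prefix_length_prefix prefix_order.antisym le_refl)
    with that show False by simp
  qed
  have fin: "finite (\<Union>j\<in>children s. sequences_from D j)"
    using finite_children sequences_from_subset finite_sequences finite_subset by blast
  have "s \<notin> (\<Union>j\<in>children s. sequences_from D j)"
    using parent_notin_sequences_from by (auto simp: children_def)
  then have "sum f (below s) = f s + sum f (\<Union>j\<in>children s. sequences_from D j)"
    using below_decomposition[OF s] fin by simp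
  also have "sum f (\<Union>j\<in>children s. sequences_from D j)
      = (\<Sum>j\<in>children s. sum f (sequences_from D j))"
    using disj finite_subset[OF sequences_from_subset finite_sequences]
    by (intro sum.UNION_disjoint finite_children) auto
  finally show ?thesis .
qed

text \<open>The coordinates that a response may fill. For a trigger \<open>(j, a)\<close> these
  include the other actions at \<open>j\<close>, since the continuation starts with a fresh choice
  there; the constant map at \<open>None\<close> rewrites everything.\<close>

fun target :: "sequence \<Rightarrow> sequence set" where
  "target None = S"
| "target (Some (j, a)) = sequences_from D j"

text \<open>The weights are chosen such that the weighted mass below a sequence that is played with
  probability \<open>1\<close> does not depend on the strategy; this turns fixed points of deviations into
  stationary vectors of a Markov chain on sequences.\<close>

definition seq_weight :: "sequence \<Rightarrow> real" where
  "seq_weight s = real (card (target s)) - real (card (below s)) + 1"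

lemma target_subset: "target s \<subseteq> S"
  by (cases s rule: target.cases) (auto simp: sequences_from_def)

lemma finite_target: "finite (target s)"
  using target_subset finite_sequences finite_subset by blast

lemma below_subset_target: "s \<in> S \<Longrightarrow> below s \<subseteq> target s"
  by (cases s rule: target.cases) (auto simp: below_None sequences_from_eq)

text \<open>Positivity of the weights makes the rescaling invertible on \<open>S\<close>.\<close>

lemma seq_weight_ge_1: "s \<in> S \<Longrightarrow> 1 \<le> seq_weight s"
  using card_mono[OF finite_target below_subset_target] by (simp add: seq_weight_def)

text \<open>This is the equation that the weights solve. All actions at a child \<open>j\<close>
  share the target \<open>sequences_from D j\<close>, so the flow equation collapses their sum to
  \<open>card (sequences_from D j) * g s\<close>. These cardinalities add up to
  \<open>card (below s) - 1\<close>, and \<open>seq_weight s\<close> supplies what is missing to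
  \<open>card (target s)\<close>.\<close>

lemma sum_seq_weight_below:
  fixes g :: strategy
  shows "s \<in> S \<Longrightarrow> (\<And>j. j \<in> J \<Longrightarrow> parent D j \<in> below s \<Longrightarrow> flow_at g j) \<Longrightarrow>
   (\<Sum>t\<in>below s. seq_weight t * g t) = card (target s) * g s"
proof (induction "card (below s)" arbitrary: s rule: less_induct)
  case less
  have IH: "(\<Sum>t\<in>below (Some (j, a)). seq_weight t * g t)
      = card (sequences_from D j) * g (Some (j, a))"
    if j: "j \<in> children s" "a \<in> actions D j" for j a
  proof -
    have jJ: "j \<in> J" "parent D j = s" using j by (auto simp: children_def)
    have sub: "below (Some (j, a)) \<subseteq> below s"
      using child_below_iff[of j a s] jJ j less.prems below_self below_trans by metis
    have "s \<notin> below (Some (j, a))"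
      using parent_notin_sequences_from[of j] jJ j mem_sequences_from by blast
    then have "below (Some (j, a)) \<subset> below s" using sub below_self less.prems by blast
    then have "card (below (Some (j, a))) < card (below s)"
      using finite_below psubset_card_mono by blast
    from less.hyps[OF this] show ?thesis using jJ j less.prems sub by auto
  qed
  have card_eq: "real (card (below s)) = 1 + (\<Sum>j\<in>children s. real (card (sequences_from D j)))"
    using sum_below[OF less.prems(1), of "\<lambda>_. 1 :: real"] by simp
  have "(\<Sum>t\<in>below s. seq_weight t * g t)
      = seq_weight s * g s + (\<Sum>j\<in>children s. \<Sum>a\<in>actions D j.
          card (sequences_from D j) * g (Some (j, a)))"
  proof -
    have "(\<Sum>t\<in>sequences_from D j. seq_weight t * g t)
        = (\<Sum>a\<in>actions D j. card (sequences_from D j) * g (Some (j, a)))"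
      if j: "j \<in> children s" for j
      using j IH by (subst sum_sequences_from) (auto simp: children_def intro!: sum.cong)
    then show ?thesis by (simp add: sum_below[OF less.prems(1)])
  qed
  also have "\<dots> = seq_weight s * g s + (\<Sum>j\<in>children s. card (sequences_from D j) * g s)"
  proof -
    have "(\<Sum>a\<in>actions D j. real (card (sequences_from D j)) * g (Some (j, a)))
        = card (sequences_from D j) * g s" if j: "j \<in> children s" for j
    proof -
      have "flow_at g j" using less.prems below_self j by (auto simp: children_def)
      then have "(\<Sum>a\<in>actions D j. g (Some (j, a))) = g s"
        using j unfolding flow_at_def children_def by simp
      then show ?thesis by (simp flip: sum_distrib_left)
    qed
    then show ?thesis by simp
  qed
  also have "\<dots> = (seq_weight s + (\<Sum>j\<in>children s. real (card (sequences_from D j)))) * g s"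
    by (simp add: distrib_right sum_distrib_right)
  also have "\<dots> = card (target s) * g s"
    using card_eq by (simp add: seq_weight_def)
  finally show ?case .
qed

end

section \<open>Deviations\<close>

context recall_tree begin

fun responses :: "sequence \<Rightarrow> strategy set" where
  "responses None = pure_strategies D"
| "responses (Some (j, a)) = pure_strategies_from D j"

definition deviations :: "(sequence \<times> strategy) set" where
  "deviations = Sigma S responses"

text \<open>For \<open>s = Some (j, a)\<close> this is the trigger deviation to the continuation \<open>r\<close>, in a form that
  is linear on the span of the strategies; for \<open>s = None\<close> it is the constant map to \<open>r\<close>.\<close>

fun deviate :: "sequence \<times> strategy \<Rightarrow> strategy \<Rightarrow> strategy" where
  "deviate (s, r) q = (\<lambda>t. q s * r t + (if t \<in> below s then 0 else q t))"

section \<open>Deviations map strategies to strategies and have constant weighted mass\<close>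

lemma strategiesD:
  assumes "q \<in> strategies D"
  shows "0 \<le> q t" "t \<notin> S \<Longrightarrow> q t = 0" "q None = 1" "j \<in> J \<Longrightarrow> flow_at q j"
  using assms by (auto simp: strategies_def flow_at_def)

lemma strategiesI:
  assumes "\<And>t. 0 \<le> q t" "\<And>t. t \<notin> S \<Longrightarrow> q t = 0" "q None = 1" "\<And>j. j \<in> J \<Longrightarrow> flow_at q j"
  shows "q \<in> strategies D"
  using assms by (auto simp: strategies_def flow_at_def)

lemma flow_below_le:
  assumes nonneg: "\<And>t. 0 \<le> q t" and flow: "\<And>j. j \<in> J \<Longrightarrow> flow_at q j"
  shows "t \<in> below s \<Longrightarrow> q t \<le> q s"
proof (induction "length (trail t)" arbitrary: t rule: less_induct)
  case less
  have tS: "t \<in> S" using less.prems below_subset by blast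
  show ?case
  proof (cases "t = s")
    case False
    have "t \<noteq> None"
    proof
      assume "t = None"
      then have "trail s = trail None" using less.prems by (simp add: below_def)
      then show False using False \<open>t = None\<close> trail_inject by metis
    qed
    then obtain j a where t: "t = Some (j, a)" by auto
    then have ja: "j \<in> J" "a \<in> actions D j" using tS by auto
    have "parent D j \<in> below s" using less.prems False t child_below_iff[OF ja, of s] by auto
    moreover have "length (trail (parent D j)) < length (trail t)"
      using t ja by (simp add: trail_parent)
    ultimately have "q (parent D j) \<le> q s" using less.hyps by blast
    moreover have "q t \<le> (\<Sum>a\<in>actions D j. q (Some (j, a)))"
      unfolding t using ja nonneg finite_actions by (intro member_le_sum) auto
    ultimately show ?thesis using flow[OF ja(1)] by (simp add: flow_at_def)
  qed simp
qed

lemma flow_le_None: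
  assumes "\<And>t. 0 \<le> q t" "\<And>j. j \<in> J \<Longrightarrow> flow_at q j" "t \<in> S"
  shows "q t \<le> q None"
  using flow_below_le[of q t None] assms by (simp add: below_None)

lemma strategy_le_1:
  assumes "q \<in> strategies D" shows "q t \<le> 1"
  using flow_le_None[of q t] strategiesD[OF assms] by (cases "t \<in> S") auto

lemma response_nonneg: "r \<in> responses s \<Longrightarrow> 0 \<le> r t"
  by (cases s rule: responses.cases)
    (auto simp: pure_strategies_def strategies_def pure_strategies_from_def strategies_from_def)

lemma response_01: "r \<in> responses s \<Longrightarrow> r t \<in> {0, 1}"
  by (cases s rule: responses.cases) (auto simp: pure_strategies_def pure_strategies_from_def)

lemma response_outside: "r \<in> responses s \<Longrightarrow> t \<notin> target s \<Longrightarrow> r t = 0"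
  by (cases s rule: responses.cases)
    (auto simp: pure_strategies_def strategies_def pure_strategies_from_def strategies_from_def)

lemma trigger_responseD:
  assumes "r \<in> responses (Some (j, a))"
  shows "(\<Sum>a\<in>actions D j. r (Some (j, a))) = 1"
    "j' \<in> J \<Longrightarrow> precedes D j j' \<Longrightarrow> flow_at r j'"
  using assms by (auto simp: pure_strategies_from_def strategies_from_def flow_at_def)

text \<open>The mass \<open>q s\<close> is erased at \<open>s\<close> and everything below it, and
  put back along \<open>r\<close>. At the triggering information set the response distributes
  exactly the amount lost, because its values there sum to 1; at every other one the erased vector
  and the response satisfy the flow equation separately.\<close>

lemma deviate_in_strategies:
  assumes s: "s \<in> S" and r: "r \<in> responses s" and q: "q \<in> strategies D"
  shows "deviate (s, r) q \<in> strategies D"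
proof (cases s)
  case None
  have "q t = 0" if "t \<notin> below s" for t
    using that None q by (simp add: below_None strategiesD)
  then have "deviate (s, r) q = r" using None strategiesD(3)[OF q] by auto
  then show ?thesis using r None by (simp add: pure_strategies_def)
next
  case (Some p)
  obtain j a where p: "p = (j, a)" by (cases p)
  have s_eq: "s = Some (j, a)" using Some p by simp
  have ja: "j \<in> J" "a \<in> actions D j" using s s_eq by auto
  note q' = strategiesD[OF q]
  have r_out: "r t = 0" if "t \<notin> sequences_from D j" for t
    using response_outside[OF r] that s_eq by simp
  show ?thesis
  proof (rule strategiesI)
    show "0 \<le> deviate (s, r) q t" for t
      using q'(1) response_nonneg[OF r] by simp
    show "deviate (s, r) q t = 0" if "t \<notin> S" for t
      using q'(2) r_out sequences_from_subset that by (auto simp: subset_eq)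
    show "deviate (s, r) q None = 1"
      using q'(3) r_out[of None] s_eq
      by (auto simp: below_def sequences_from_def seq_at_or_below_def)
    fix j' assume j': "j' \<in> J"
    let ?p = "parent D j'"
    have flow: "q ?p = (\<Sum>a\<in>actions D j'. q (Some (j', a)))"
      using q'(4)[OF j'] by (simp add: flow_at_def)
    show "flow_at (deviate (s, r) q) j'"
    proof (cases "j' = j")
      case True
      have p_out: "?p \<notin> sequences_from D j"
        using parent_notin_sequences_from[OF j'] True by simp
      have p_nb: "?p \<notin> below s"
        using p_out ja s_eq mem_sequences_from by blast
      have iff: "Some (j, a') \<in> below s \<longleftrightarrow> a' = a" if "a' \<in> actions D j" for a'
        using child_below_iff[OF ja(1) that, of s] p_nb True s_eq by auto
      have "(\<Sum>a'\<in>actions D j. deviate (s, r) q (Some (j, a')))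
          = q s * (\<Sum>a'\<in>actions D j. r (Some (j, a')))
            + (\<Sum>a'\<in>actions D j. if a' = a then 0 else q (Some (j, a')))"
        using iff by (simp add: sum.distrib sum_distrib_left)
      also have "\<dots> = q s + (\<Sum>a'\<in>actions D j - {a}. q (Some (j, a')))"
        using trigger_responseD(1)[of r j a] r s_eq ja finite_actions
        by (simp add: sum.remove[of _ a])
      also have "\<dots> = q ?p"
        using flow True ja finite_actions s_eq by (simp add: sum.remove[of _ a])
      finally show ?thesis
        using p_out p_nb r_out True by (simp add: flow_at_def)
    next
      case False
      \<comment> \<open>Away from \<open>j\<close> the parent and all actions of an information set
        are erased together or not at all.\<close>
      have iff: "Some (j', a') \<in> below s \<longleftrightarrow> ?p \<in> below s" if "a' \<in> actions D j'" for a'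
        using child_below_iff[OF j' that, of s] False s_eq by auto
      have r_flow: "r ?p = (\<Sum>a\<in>actions D j'. r (Some (j', a)))"
      proof (cases "precedes D j j'")
        case True
        then show ?thesis
          using trigger_responseD(2)[of r j a j'] r s_eq j' by (simp add: flow_at_def)
      next
        case nprec: False
        have "?p \<notin> sequences_from D j"
        proof
          assume "?p \<in> sequences_from D j"
          then obtain b where "?p \<in> below (Some (j, b))" using mem_sequences_from ja by blast
          then have "(j, b) \<in> set (h j')"
            using prefix_mem_trail[of j b ?p] j' by (simp add: below_def trail_parent)
          then show False using nprec ja j' by (auto simp: precedes_iff)
        qed
        moreover have "Some (j', b) \<notin> sequences_from D j" for b
          using nprec False by (auto simp: sequences_from_def seq_at_or_below_def)
        ultimately show ?thesis using r_out by simp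
      qed
      show ?thesis
        using iff flow r_flow by (simp add: flow_at_def sum.distrib sum_distrib_left)
    qed
  qed
qed

lemma sum_seq_weight_strategy:
  assumes q: "q \<in> strategies D" and s: "s \<in> S"
  shows "(\<Sum>t\<in>below s. seq_weight t * q t) = real (card (target s)) * q s"
  by (rule sum_seq_weight_below[OF s]) (rule strategiesD(4)[OF q])

text \<open>The mass does not depend on \<open>r\<close>, since the values of \<open>r\<close> at
  \<open>j\<close> sum to 1 and all actions at \<open>j\<close> share a target. This is what makes
  \<open>transition\<close> stochastic.\<close>

lemma sum_seq_weight_response:
  assumes s: "s \<in> S" and r: "r \<in> responses s"
  shows "(\<Sum>t\<in>S. seq_weight t * r t) = real (card (target s))"
proof (cases s)
  case None
  then have "r \<in> strategies D" using r by (simp add: pure_strategies_def)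
  then show ?thesis
    using sum_seq_weight_strategy[of r None] None strategiesD(3) by (simp add: below_None)
next
  case (Some p)
  obtain j a where p: "p = (j, a)" by (cases p)
  have s_eq: "s = Some (j, a)" using Some p by simp
  have ja: "j \<in> J" "a \<in> actions D j" using s s_eq by auto
  have "(\<Sum>t\<in>S. seq_weight t * r t) = (\<Sum>t\<in>sequences_from D j. seq_weight t * r t)"
    using response_outside[OF r] s_eq finite_sequences sequences_from_subset
    by (intro sum.mono_neutral_right) auto
  also have "\<dots> = (\<Sum>b\<in>actions D j. \<Sum>t\<in>below (Some (j, b)). seq_weight t * r t)"
    by (rule sum_sequences_from[OF ja(1)])
  also have "\<dots> = (\<Sum>b\<in>actions D j. real (card (sequences_from D j)) * r (Some (j, b)))"
  proof (rule sum.cong[OF refl])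
    fix b assume b: "b \<in> actions D j"
    have "flow_at r j'" if j': "j' \<in> J" "parent D j' \<in> below (Some (j, b))" for j'
    proof -
      have "(j, b) \<in> set (h j')"
        using prefix_mem_trail[of j b "parent D j'"] j' by (simp add: below_def trail_parent)
      then have "precedes D j j'" using ja j' by (auto simp: precedes_iff)
      then show ?thesis using trigger_responseD(2)[of r j a j'] r s_eq j' by simp
    qed
    then show "(\<Sum>t\<in>below (Some (j, b)). seq_weight t * r t)
        = real (card (sequences_from D j)) * r (Some (j, b))"
      using sum_seq_weight_below[of "Some (j, b)" r] ja b by simp
  qed
  also have "\<dots> = real (card (target s))"
    using trigger_responseD(1)[of r j a] r s_eq by (simp flip: sum_distrib_left)
  finally show ?thesis .
qed

lemma responses_subset:
  assumes "s \<in> S" shows "responses s \<subseteq> indicator ` Pow S"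
proof
  fix r assume r: "r \<in> responses s"
  have "r = indicator {t \<in> S. r t = 1}"
  proof
    fix t
    show "r t = indicator {t \<in> S. r t = 1} t"
      using response_01[OF r, of t] response_outside[OF r, of t] target_subset
      by (auto simp: indicator_def)
  qed
  then show "r \<in> indicator ` Pow S" by blast
qed

lemma finite_responses: "s \<in> S \<Longrightarrow> finite (responses s)"
  using finite_subset[OF responses_subset] finite_sequences by simp

lemma card_responses: "s \<in> S \<Longrightarrow> card (responses s) \<le> 2 ^ card S"
proof -
  assume s: "s \<in> S"
  have "card (responses s) \<le> card ((indicator :: _ \<Rightarrow> strategy) ` Pow S)"
    using responses_subset[OF s] finite_sequences by (intro card_mono) auto
  also have "\<dots> \<le> card (Pow S)" using finite_sequences by (intro card_image_le) simp
  also have "\<dots> = 2 ^ card S" using finite_sequences by (rule card_Pow)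
  finally show ?thesis .
qed

lemma finite_deviations: "finite deviations"
  using finite_responses finite_sequences by (auto simp: deviations_def)

text \<open>The exponential size is harmless, as only its logarithm enters the regret.\<close>

lemma card_deviations: "card deviations \<le> 2 ^ (2 * card S)"
proof -
  have "card deviations = (\<Sum>s\<in>S. card (responses s))"
    unfolding deviations_def using finite_responses finite_sequences by (simp add: card_SigmaI)
  also have "\<dots> \<le> (\<Sum>s\<in>S. 2 ^ card S)" by (intro sum_mono card_responses)
  also have "\<dots> = card S * 2 ^ card S" by simp
  also have "\<dots> \<le> 2 ^ card S * 2 ^ card S" by (intro mult_right_mono) (auto simp: less_imp_le)
  also have "\<dots> = 2 ^ (2 * card S)" by (simp add: mult_2 power_add)
  finally show ?thesis .
qed

section \<open>Pure strategies and decomposition of flows\<close>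

definition choice_strategy :: "(nat \<Rightarrow> nat) \<Rightarrow> strategy" where
  "choice_strategy c t = (if t \<in> S \<and> (\<forall>(j, a)\<in>set (trail t). a = c j) then 1 else 0)"

lemma choice_strategy_pure:
  assumes c: "\<And>j. j \<in> J \<Longrightarrow> c j \<in> actions D j"
  shows "choice_strategy c \<in> pure_strategies D"
proof -
  have "choice_strategy c \<in> strategies D"
  proof (rule strategiesI)
    fix j assume j: "j \<in> J"
    have "choice_strategy c (Some (j, a)) = (if a = c j then choice_strategy c (parent D j) else 0)"
      if "a \<in> actions D j" for a
      using j that parent_in_sequences by (auto simp: choice_strategy_def trail_parent)
    then have "(\<Sum>a\<in>actions D j. choice_strategy c (Some (j, a)))
        = (\<Sum>a\<in>actions D j. if a = c j then choice_strategy c (parent D j) else 0)"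
      by simp
    then show "flow_at (choice_strategy c) j"
      using c[OF j] j finite_actions by (simp add: flow_at_def)
  qed (auto simp: choice_strategy_def)
  then show ?thesis by (simp add: pure_strategies_def choice_strategy_def)
qed

text \<open>For positivity of the chain: some constant map must lead to each sequence. The choice
  follows the trail of \<open>t\<close> where it can and is arbitrary elsewhere.\<close>

lemma pure_strategy_through:
  assumes t: "t \<in> S"
  shows "\<exists>r\<in>pure_strategies D. r t = 1"
proof -
  define c where "c j = (SOME a. if \<exists>b. (j, b) \<in> set (trail t) then (j, a) \<in> set (trail t)
    else a \<in> actions D j)" for j
  have c: "if \<exists>b. (j, b) \<in> set (trail t) then (j, c j) \<in> set (trail t) else c j \<in> actions D j"
    if "j \<in> J" for j
    unfolding c_def by (rule someI_ex) (use actions_nonempty[OF that] in \<open>auto simp: ex_in_conv\<close>)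
  have "c j \<in> actions D j" if "j \<in> J" for j
    using c[OF that] mem_trail_prefix(1)[OF t, of j "c j"] by (auto split: if_splits)
  then have "choice_strategy c \<in> pure_strategies D" by (rule choice_strategy_pure)
  moreover have "choice_strategy c t = 1"
  proof -
    have "a = c j" if ja: "(j, a) \<in> set (trail t)" for j a
    proof -
      have "j \<in> J" using mem_trail_prefix(1)[OF t ja] by simp
      then have "(j, c j) \<in> set (trail t)" using c ja by meson
      then show ?thesis using trail_action_unique t ja by blast
    qed
    then show ?thesis using t by (auto simp: choice_strategy_def)
  qed
  ultimately show ?thesis by blast
qed

lemma deviations_nonempty: "deviations \<noteq> {}"
proof -
  obtain r where "r \<in> pure_strategies D" using pure_strategy_through[of None] by auto
  then have "(None, r) \<in> deviations" by (simp add: deviations_def)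
  then show ?thesis by blast
qed

lemma pure_strategies_nonempty: "pure_strategies D \<noteq> {}"
  using pure_strategy_through[of None] by auto

text \<open>A flow is a nonnegative combination of pure strategies: subtracting the largest possible
  multiple of a pure strategy supported in its support shrinks the support.\<close>

lemma flow_induct:
  assumes nonneg: "\<And>t. 0 \<le> q t" and out: "\<And>t. t \<notin> S \<Longrightarrow> q t = 0"
    and flow: "\<And>j. j \<in> J \<Longrightarrow> flow_at q j"
    and zero: "Q (\<lambda>_. 0)"
    and add: "\<And>q c p. Q q \<Longrightarrow> p \<in> pure_strategies D \<Longrightarrow> Q (\<lambda>t. q t + c * p t)"
  shows "Q q"
  using nonneg out flow
proof (induction "card {t \<in> S. q t \<noteq> 0}" arbitrary: q rule: less_induct)
  case less
  show ?case
  proof (cases "q None = 0")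
    case True
    have "q t = 0" for t
    proof (cases "t \<in> S")
      case True
      then show ?thesis
        using flow_le_None[of q t] less.prems \<open>q None = 0\<close> by (metis order.antisym)
    qed (use less.prems in auto)
    then have "q = (\<lambda>_. 0)" by auto
    then show ?thesis using zero by simp
  next
    case False
    \<comment> \<open>Following an action with positive flow wherever there is flow keeps the
      resulting pure strategy inside the support of \<open>q\<close>.\<close>
    define c where "c j = (SOME a. a \<in> actions D j \<and> (0 < q (parent D j) \<longrightarrow> 0 < q (Some (j, a))))" for j
    have c: "c j \<in> actions D j \<and> (0 < q (parent D j) \<longrightarrow> 0 < q (Some (j, c j)))" if j: "j \<in> J" for j
      unfolding c_def
    proof (rule someI_ex)
      show "\<exists>a. a \<in> actions D j \<and> (0 < q (parent D j) \<longrightarrow> 0 < q (Some (j, a)))"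
      proof (rule ccontr)
        assume "\<not> ?thesis"
        then have "0 < q (parent D j)" "\<forall>a\<in>actions D j. q (Some (j, a)) = 0"
          using actions_nonempty[OF j] less.prems(1) by (auto simp: not_less intro: order.antisym)
        then show False using less.prems(3)[OF j] by (simp add: flow_at_def)
      qed
    qed
    define p where "p = choice_strategy c"
    have p: "p \<in> pure_strategies D" unfolding p_def using c by (intro choice_strategy_pure) auto
    then have ps: "p \<in> strategies D" by (simp add: pure_strategies_def)
    have supp: "0 < q t" if "p t \<noteq> 0" for t
      using that
    proof (induction "length (trail t)" arbitrary: t rule: less_induct)
      case (less t)
      have t: "t \<in> S" "\<forall>(j, a)\<in>set (trail t). a = c j"
        using less.prems by (auto simp: p_def choice_strategy_def split: if_splits)
      show ?case
      proof (cases t)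
        case None
        then show ?thesis using False \<open>\<And>t. 0 \<le> q t\<close> by (auto simp: less_le)
      next
        case (Some ja)
        then obtain j a where ja: "t = Some (j, a)" "j \<in> J" "a = c j" using t by (cases ja) auto
        have "p (parent D j) \<noteq> 0"
          using t ja parent_in_sequences by (auto simp: p_def choice_strategy_def trail_parent)
        then have "0 < q (parent D j)" using less.hyps ja by (simp add: trail_parent)
        then show ?thesis using c ja by auto
      qed
    qed
    define A where "A = {t \<in> S. p t \<noteq> 0}"
    have A: "finite A" "None \<in> A" using finite_sequences strategiesD(3)[OF ps] by (auto simp: A_def)
    have pA: "p t = 1" if "t \<in> A" for t using that p by (auto simp: A_def pure_strategies_def)
    have pnA: "p t = 0" if "t \<notin> A" for t
      using that strategiesD(2)[OF ps] by (auto simp: A_def)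
    define m where "m = Min (q ` A)"
    have m_le: "m \<le> q t" if "t \<in> A" for t using A that by (simp add: m_def)
    have "m \<in> q ` A" unfolding m_def using A by (intro Min_in) auto
    then obtain t0 where t0: "t0 \<in> A" "q t0 = m" by auto
    have qt0: "0 < q t0" using t0 supp by (auto simp: A_def)
    define q' where "q' = (\<lambda>t. q t - m * p t)"
    have "Q q'"
    proof (rule less.hyps)
      have "{t \<in> S. q' t \<noteq> 0} \<subseteq> {t \<in> S. q t \<noteq> 0}"
        using supp by (auto simp: q'_def) (metis less_irrefl mult_zero_right diff_zero)
      moreover have "t0 \<in> {t \<in> S. q t \<noteq> 0}"
        using t0(1) qt0 by (simp add: A_def)
      moreover have "t0 \<notin> {t \<in> S. q' t \<noteq> 0}"
        using t0(2) pA[OF t0(1)] by (simp add: q'_def)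
      ultimately have "{t \<in> S. q' t \<noteq> 0} \<subset> {t \<in> S. q t \<noteq> 0}" by blast
      then show "card {t \<in> S. q' t \<noteq> 0} < card {t \<in> S. q t \<noteq> 0}"
        using finite_sequences by (intro psubset_card_mono) auto
      show "0 \<le> q' t" for t
        using m_le[of t] pA[of t] pnA[of t] less.prems(1)[of t] by (cases "t \<in> A") (auto simp: q'_def)
      show "q' t = 0" if "t \<notin> S" for t
        using that less.prems(2) strategiesD(2)[OF ps] by (simp add: q'_def)
      show "flow_at q' j" if "j \<in> J" for j
        using less.prems(3)[OF that] strategiesD(4)[OF ps that]
        by (simp add: q'_def flow_at_def sum_subtractf sum_distrib_left)
    qed
    then have "Q (\<lambda>t. q' t + m * p t)" using p by (rule add)
    then show ?thesis by (simp add: q'_def)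
  qed
qed

text \<open>A trigger deviation is specified on pure strategies only. Agreement with
  \<open>deviate\<close> there spreads to all strategies by linearity and the decomposition of
  flows.\<close>

lemma trigger_deviation_deviate:
  assumes f: "f \<in> trigger_deviations D"
  obtains s r where "(s, r) \<in> deviations" "\<And>q. q \<in> strategies D \<Longrightarrow> f q = deviate (s, r) q"
proof -
  obtain j a r where ja: "j \<in> J" "a \<in> actions D j" and r: "r \<in> pure_strategies_from D j"
    and f: "is_trigger_deviation D j a r f"
    using f by (auto simp: trigger_deviations_def)
  define s where "s = Some (j, a)"
  have dev: "(s, r) \<in> deviations" using ja r by (simp add: deviations_def s_def)
  have r': "r \<in> responses s" using r by (simp add: s_def)
  obtain M where M: "\<And>q. f q = (\<lambda>t. if t \<in> S then \<Sum>t'\<in>S. M t t' * q t' else 0)"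
    using f by (auto simp: is_trigger_deviation_def linear_map_def)
  have pure: "f p = deviate (s, r) p" if p: "p \<in> pure_strategies D" for p
  proof -
    have ps: "p \<in> strategies D" using p by (simp add: pure_strategies_def)
    note p' = strategiesD[OF ps]
    have "p s = 0 \<or> p s = 1" using p by (simp add: pure_strategies_def)
    then show ?thesis
    proof
      assume ps0: "p s = 0"
      have "p t = 0" if "t \<in> below s" for t
        using flow_below_le[of p t s] p' that ps0 by (metis order.antisym)
      then have "deviate (s, r) p = p" using ps0 by auto
      then show ?thesis using f p ps0 by (simp add: is_trigger_deviation_def s_def)
    next
      assume ps1: "p s = 1"
      have fp: "f p = (\<lambda>t. if seq_at_or_below D j t then r t else p t)"
        using f p ps1 by (simp add: is_trigger_deviation_def s_def)
      \<comment> \<open>A pure strategy that plays \<open>a\<close> vanishes under the other actions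
        at \<open>j\<close>; so erasing \<open>below s\<close> has the same effect as overwriting
        all of \<open>sequences_from D j\<close>.\<close>
      have other: "p (Some (j, b)) = 0" if "b \<in> actions D j" "b \<noteq> a" for b
      proof -
        have "p (Some (j, a)) + p (Some (j, b)) = (\<Sum>b\<in>{a, b}. p (Some (j, b)))"
          using that by simp
        also have "\<dots> \<le> (\<Sum>b\<in>actions D j. p (Some (j, b)))"
          using that ja p' finite_actions by (intro sum_mono2) auto
        also have "\<dots> \<le> 1"
          using p'(4)[OF ja(1)] strategy_le_1[OF ps] by (metis flow_at_def)
        finally show ?thesis using ps1 p'(1)[of "Some (j, b)"] by (simp add: s_def)
      qed
      show ?thesis
      proof
        fix t
        show "f p t = deviate (s, r) p t"
        proof (cases "t \<in> sequences_from D j")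
          case True
          then obtain b where b: "b \<in> actions D j" "t \<in> below (Some (j, b))"
            using mem_sequences_from ja by blast
          have "p t = 0" if "t \<notin> below s"
          proof -
            have "b \<noteq> a" using b that by (auto simp: s_def)
            then show ?thesis
              using flow_below_le[of p t "Some (j, b)"] p' b other by (metis order.antisym)
          qed
          then show ?thesis using True fp ps1 by (simp add: sequences_from_def)
        next
          case False
          then have "r t = 0" using response_outside[OF r'] by (simp add: s_def)
          moreover have "t \<notin> below s" using False mem_sequences_from ja by (auto simp: s_def)
          ultimately show ?thesis
            using False fp p'(2)[of t] by (auto simp: sequences_from_def)
        qed
      qed
    qed
  qed
  have "f q = deviate (s, r) q" if q: "q \<in> strategies D" for q
  proof (rule flow_induct[of q "\<lambda>q. f q = deviate (s, r) q"])
    show "f (\<lambda>_. 0) = deviate (s, r) (\<lambda>_. 0)" by (auto simp: M)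
    fix q c p
    assume IH: "f q = deviate (s, r) q" and p: "p \<in> pure_strategies D"
    have "f (\<lambda>t. q t + c * p t) = (\<lambda>t. f q t + c * f p t)"
      by (auto simp: M algebra_simps sum.distrib sum_distrib_left)
    also have "\<dots> = deviate (s, r) (\<lambda>t. q t + c * p t)"
      unfolding IH pure[OF p] by (auto simp: algebra_simps)
    finally show "f (\<lambda>t. q t + c * p t) = deviate (s, r) (\<lambda>t. q t + c * p t)" .
  qed (use strategiesD[OF q] in auto)
  then show thesis using that dev by blast
qed

end

section \<open>Fixed points of mixtures of deviations\<close>

context recall_tree begin

definition mixture :: "(sequence \<times> strategy \<Rightarrow> real) \<Rightarrow> strategy \<Rightarrow> strategy" where
  "mixture x q = (\<lambda>t. \<Sum>d\<in>deviations. x d * deviate d q t)"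

text \<open>The chain of a single deviation: a state below the trigger jumps according to the
  weighted response, wherever it is, and other states stay put. Dividing by
  \<open>card (target s)\<close> normalises, since this is the weighted mass of every response to
  \<open>s\<close>.\<close>

fun transition :: "sequence \<times> strategy \<Rightarrow> sequence \<Rightarrow> sequence \<Rightarrow> real" where
  "transition (s, r) t u =
     (if t \<in> below s then seq_weight u * r u / card (target s) else if t = u then 1 else 0)"

definition kernel :: "(sequence \<times> strategy \<Rightarrow> real) \<Rightarrow> sequence \<Rightarrow> sequence \<Rightarrow> real" where
  "kernel x t u = (\<Sum>d\<in>deviations. x d * transition d t u)"

definition mixing_weights :: "(sequence \<times> strategy \<Rightarrow> real) \<Rightarrow> bool" where
  "mixing_weights x \<longleftrightarrow> (\<forall>d\<in>deviations. 0 < x d) \<and> (\<Sum>d\<in>deviations. x d) = 1"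

section \<open>The Markov chain belonging to a mixture of deviations\<close>

lemma card_target_pos: "s \<in> S \<Longrightarrow> 0 < real (card (target s))"
  using below_subset_target below_self finite_target by (fastforce simp: card_gt_0_iff)

lemma transition_nonneg:
  "d \<in> deviations \<Longrightarrow> u \<in> S \<Longrightarrow> 0 \<le> transition d t u"
  using seq_weight_ge_1[of u] response_nonneg[of _ _ u] by (cases d) (auto simp: deviations_def)

lemma sum_transition:
  assumes d: "d \<in> deviations" and t: "t \<in> S"
  shows "(\<Sum>u\<in>S. transition d t u) = 1"
proof -
  obtain s r where sr: "d = (s, r)" by (cases d)
  show ?thesis
  proof (cases "t \<in> below s")
    case True
    have "(\<Sum>u\<in>S. seq_weight u * r u / card (target s)) = 1"
      using sum_seq_weight_response[of s r] d sr card_target_pos[of s]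
      by (auto simp: deviations_def simp flip: sum_divide_distrib)
    then show ?thesis using True sr by simp
  next
    case False
    then show ?thesis using t sr finite_sequences by simp
  qed
qed

text \<open>On rescaled strategies the chain acts as the deviation does: the weighted mass below the
  trigger is \<open>card (target s) * q s\<close>, and its first factor cancels the normalisation,
  leaving the amount \<open>q s\<close> that is sent to the response.\<close>

lemma sum_transition_strategy:
  assumes d: "d \<in> deviations" and q: "q \<in> strategies D" and u: "u \<in> S"
  shows "(\<Sum>t\<in>S. (seq_weight t * q t) * transition d t u) = seq_weight u * deviate d q u"
proof -
  obtain s r where sr: "d = (s, r)" by (cases d)
  have s: "s \<in> S" using d sr by (simp add: deviations_def)
  let ?w = "seq_weight u * r u / card (target s)"
  have "(\<Sum>t\<in>S. (seq_weight t * q t) * transition d t u)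
      = (\<Sum>t\<in>S. (if t \<in> below s then seq_weight t * q t * ?w else 0) +
           (if t = u then if t \<in> below s then 0 else seq_weight t * q t else 0))"
    unfolding sr by (intro sum.cong) auto
  also have "\<dots> = (\<Sum>t\<in>below s. seq_weight t * q t * ?w)
      + (if u \<in> below s then 0 else seq_weight u * q u)"
    using u finite_sequences below_subset
    by (simp add: sum.distrib sum.inter_restrict[symmetric] Int_absorb1)
  also have "(\<Sum>t\<in>below s. seq_weight t * q t * ?w) = card (target s) * q s * ?w"
    unfolding sum_distrib_right[symmetric] sum_seq_weight_strategy[OF q s] ..
  also have "\<dots> = seq_weight u * (q s * r u)"
    using card_target_pos[OF s] by simp
  finally show ?thesis by (simp add: sr distrib_left)
qed

declare transition.simps [simp del] deviate.simps [simp del]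

lemma kernel_positive_stochastic:
  assumes x: "mixing_weights x"
  shows "positive_stochastic S (kernel x)"
  unfolding positive_stochastic_def
proof (intro conjI ballI)
  fix t u assume tu: "t \<in> S" "u \<in> S"
  obtain r where r: "r \<in> pure_strategies D" "r u = 1" using pure_strategy_through tu by blast
  have d: "(None, r) \<in> deviations" using r by (simp add: deviations_def)
  have "0 < transition (None, r) t u"
    using tu r seq_weight_ge_1[of u] card_target_pos[of None]
    by (simp add: transition.simps below_None)
  then have "0 < x (None, r) * transition (None, r) t u"
    using x d by (simp add: mixing_weights_def)
  then show "0 < kernel x t u"
    unfolding kernel_def using x transition_nonneg tu(2)
    by (intro sum_pos2[OF finite_deviations d]) (auto simp: mixing_weights_def less_imp_le)
next
  fix t assume t: "t \<in> S"
  have "(\<Sum>u\<in>S. kernel x t u) = (\<Sum>d\<in>deviations. x d * (\<Sum>u\<in>S. transition d t u))"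
    unfolding kernel_def sum_distrib_left by (rule sum.swap)
  also have "\<dots> = (\<Sum>d\<in>deviations. x d)"
    using t by (simp add: sum_transition)
  finally show "(\<Sum>u\<in>S. kernel x t u) = 1" using x by (simp add: mixing_weights_def)
qed

text \<open>The kernel is linear in the weights with nonnegative coefficients, so relative bounds
  pass through unchanged.\<close>

lemma kernel_le:
  assumes le: "\<And>d. d \<in> deviations \<Longrightarrow> x' d \<le> c * x d" and u: "u \<in> S"
  shows "kernel x' t u \<le> c * kernel x t u"
  unfolding kernel_def sum_distrib_left mult.assoc[symmetric]
  by (intro sum_mono mult_right_mono le transition_nonneg u)

lemma kernel_step:
  assumes q: "q \<in> strategies D" and u: "u \<in> S"
  shows "(\<Sum>t\<in>S. (seq_weight t * q t) * kernel x t u) = seq_weight u * mixture x q u"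
proof -
  have "(\<Sum>t\<in>S. (seq_weight t * q t) * kernel x t u)
      = (\<Sum>d\<in>deviations. x d * (\<Sum>t\<in>S. (seq_weight t * q t) * transition d t u))"
    unfolding kernel_def sum_distrib_left by (subst sum.swap) (simp add: mult_ac)
  also have "\<dots> = seq_weight u * mixture x q u"
    using assms by (simp add: sum_transition_strategy mixture_def sum_distrib_left mult.left_commute)
  finally show ?thesis .
qed

lemma deviation_in_strategies:
  "d \<in> deviations \<Longrightarrow> q \<in> strategies D \<Longrightarrow> deviate d q \<in> strategies D"
  using deviate_in_strategies by (cases d) (auto simp: deviations_def)

lemma mixture_in_strategies:
  assumes x: "mixing_weights x" and q: "q \<in> strategies D"
  shows "mixture x q \<in> strategies D"
proof (rule strategiesI)
  note dev = strategiesD[OF deviation_in_strategies[OF _ q]]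
  show "0 \<le> mixture x q t" for t
    unfolding mixture_def using x dev(1)
    by (intro sum_nonneg mult_nonneg_nonneg) (auto simp: mixing_weights_def less_imp_le)
  show "mixture x q t = 0" if "t \<notin> S" for t
    unfolding mixture_def using dev(2)[OF _ that] by (intro sum.neutral) auto
  show "mixture x q None = 1"
    using x dev(3) by (simp add: mixture_def mixing_weights_def)
  fix j assume j: "j \<in> J"
  have "mixture x q (parent D j)
      = (\<Sum>d\<in>deviations. \<Sum>a\<in>actions D j. x d * deviate d q (Some (j, a)))"
    unfolding mixture_def
    using dev(4)[OF _ j] by (intro sum.cong) (auto simp: flow_at_def sum_distrib_left)
  also have "\<dots> = (\<Sum>a\<in>actions D j. mixture x q (Some (j, a)))"
    unfolding mixture_def by (rule sum.swap)
  finally show "flow_at (mixture x q) j" by (simp add: flow_at_def)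
qed

section \<open>Existence and stability of fixed points\<close>

lemma strategies_closed:
  assumes X: "\<And>n. X n \<in> strategies D" and lim: "\<And>t. (\<lambda>n. X n t) \<longlonglongrightarrow> q t"
  shows "q \<in> strategies D"
proof (rule strategiesI)
  note X' = strategiesD[OF X]
  show "0 \<le> q t" for t
    by (rule LIMSEQ_le_const[OF lim]) (use X'(1) in auto)
  show "q t = 0" if "t \<notin> S" for t
    using lim[of t] X'(2)[OF that] by (simp add: LIMSEQ_const_iff)
  show "q None = 1"
    using lim[of None] X'(3) by (simp add: LIMSEQ_const_iff)
  fix j assume j: "j \<in> J"
  have "(\<lambda>n. X n (parent D j)) \<longlonglongrightarrow> (\<Sum>a\<in>actions D j. q (Some (j, a)))"
    unfolding X'(4)[OF j, unfolded flow_at_def] by (intro tendsto_sum lim)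
  then show "flow_at q j" unfolding flow_at_def using lim LIMSEQ_unique by blast
qed

text \<open>Power iteration started at a rescaled strategy remains among the rescaled strategies,
  because a step of the chain is an application of \<open>mixture\<close>. The limit is therefore a
  stationary vector that comes from a strategy, and dividing by the weights gives the fixed
  point.\<close>

lemma fixed_strategy_exists:
  assumes x: "mixing_weights x"
  shows "\<exists>q\<in>strategies D. mixture x q = q"
proof -
  define K where "K = (\<lambda>q t. seq_weight t * q t) ` strategies D"
  obtain p where p: "p \<in> strategies D"
    using pure_strategies_nonempty by (auto simp: pure_strategies_def)
  have "\<exists>v\<in>K. stationary S (kernel x) v"
  proof (rule stationary_in_closed_invariant_set[OF finite_sequences _ kernel_positive_stochastic[OF x]])
    show "S \<noteq> {}" using None_in_sequences by blast
    show "(\<lambda>t. seq_weight t * p t) \<in> K" using p by (auto simp: K_def)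
    show "seq_weight b * p b = 0" if "b \<notin> S" for b using strategiesD(2)[OF p that] by simp
    show "(\<lambda>b. if b \<in> S then \<Sum>a\<in>S. v a * kernel x a b else 0) \<in> K" if v: "v \<in> K" for v
    proof -
      obtain q where q: "q \<in> strategies D" "v = (\<lambda>t. seq_weight t * q t)"
        using v by (auto simp: K_def)
      have m: "mixture x q \<in> strategies D" using x q by (intro mixture_in_strategies)
      have "(\<lambda>b. if b \<in> S then \<Sum>a\<in>S. v a * kernel x a b else 0)
          = (\<lambda>t. seq_weight t * mixture x q t)"
        using kernel_step[OF q(1)] strategiesD(2)[OF m] unfolding q(2) by auto
      then show ?thesis using m by (auto simp: K_def)
    qed
    show "v \<in> K" if X: "\<And>n. X n \<in> K" "\<And>b. (\<lambda>n. X n b) \<longlonglongrightarrow> v b" for X v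
    proof -
      have "\<forall>n. \<exists>q. q \<in> strategies D \<and> X n = (\<lambda>t. seq_weight t * q t)"
        using X(1) by (auto simp: K_def)
      then obtain Y where Y: "\<And>n. Y n \<in> strategies D" "\<And>n. X n = (\<lambda>t. seq_weight t * Y n t)"
        by metis
      \<comment> \<open>Dividing by the weights is safe on \<open>S\<close>; off \<open>S\<close>
        strategies vanish, which accounts for the default 0.\<close>
      define q where "q t = (if t \<in> S then v t / seq_weight t else 0)" for t
      have lim: "(\<lambda>n. Y n t) \<longlonglongrightarrow> q t" for t
      proof (cases "t \<in> S")
        case True
        have "(\<lambda>n. X n t / seq_weight t) \<longlonglongrightarrow> v t / seq_weight t"
          using seq_weight_ge_1[OF True] by (intro tendsto_divide X tendsto_const) auto
        then show ?thesis using True seq_weight_ge_1[OF True] by (simp add: Y(2) q_def)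
      next
        case False
        then show ?thesis using strategiesD(2)[OF Y(1)] by (simp add: q_def)
      qed
      have "v t = seq_weight t * q t" for t
        using tendsto_mult[OF tendsto_const lim, of "seq_weight t" t] X(2)[of t]
        unfolding Y(2) by (rule LIMSEQ_unique[rotated])
      then show ?thesis using strategies_closed[OF Y(1) lim] by (auto simp: K_def)
    qed
  qed
  then obtain q where q: "q \<in> strategies D" "stationary S (kernel x) (\<lambda>t. seq_weight t * q t)"
    by (auto simp: K_def)
  have "mixture x q t = q t" for t
  proof (cases "t \<in> S")
    case True
    have "seq_weight t * mixture x q t = seq_weight t * q t"
      using stationaryD[OF q(2) True] kernel_step[OF q(1) True] by simp
    then show ?thesis using seq_weight_ge_1[OF True] by simp
  next
    case False
    then show ?thesis
      using strategiesD(2)[OF mixture_in_strategies[OF x q(1)]] strategiesD(2)[OF q(1)] by simp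
  qed
  then show ?thesis using q(1) by auto
qed

definition fixed_strategy :: "(sequence \<times> strategy \<Rightarrow> real) \<Rightarrow> strategy" where
  "fixed_strategy x = (SOME q. q \<in> strategies D \<and> mixture x q = q)"

lemma fixed_strategy:
  assumes "mixing_weights x"
  shows "fixed_strategy x \<in> strategies D" "mixture x (fixed_strategy x) = fixed_strategy x"
  using someI_ex[OF fixed_strategy_exists[OF assms, unfolded Bex_def]]
  by (auto simp: fixed_strategy_def)

lemma fixed_strategy_pos:
  assumes x: "mixing_weights x" and t: "t \<in> S"
  shows "0 < fixed_strategy x t"
proof -
  let ?q = "fixed_strategy x"
  note fs = fixed_strategy[OF x]
  note dev = strategiesD[OF deviation_in_strategies[OF _ fs(1)]]
  obtain r where r: "r \<in> pure_strategies D" "r t = 1" using pure_strategy_through t by blast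
  have d: "(None, r) \<in> deviations" using r by (simp add: deviations_def)
  have "0 < x (None, r) * deviate (None, r) ?q t"
    using x d r strategiesD(3)[OF fs(1)] t by (simp add: deviate.simps mixing_weights_def below_None)
  then have "0 < mixture x ?q t"
    unfolding mixture_def using x dev(1)
    by (intro sum_pos2[OF finite_deviations d]) (auto simp: mixing_weights_def less_imp_le)
  then show ?thesis by (simp add: fs(2))
qed

text \<open>All rescaled fixed points have mass \<open>card S\<close>, so they can be compared as
  stationary vectors; the weights are the same on both sides and cancel.\<close>

lemma fixed_strategy_perturbation:
  assumes x: "mixing_weights x" and x': "mixing_weights x'" and c: "1 \<le> c"
    and le: "\<And>d. d \<in> deviations \<Longrightarrow> x' d \<le> c * x d" "\<And>d. d \<in> deviations \<Longrightarrow> x d \<le> c * x' d"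
  shows "fixed_strategy x' t \<le> c ^ (2 * card S) * fixed_strategy x t"
proof (cases "t \<in> S")
  case True
  have stat: "stationary S (kernel y) (\<lambda>t. seq_weight t * fixed_strategy y t)"
    and pos: "\<And>t. t \<in> S \<Longrightarrow> 0 < seq_weight t * fixed_strategy y t"
    and mass: "(\<Sum>t\<in>S. seq_weight t * fixed_strategy y t) = card S"
    if y: "mixing_weights y" for y
  proof -
    note fs = fixed_strategy[OF y]
    show "stationary S (kernel y) (\<lambda>t. seq_weight t * fixed_strategy y t)"
      using kernel_step[OF fs(1), of _ y] fs(2) by (simp add: stationary_def)
    show "0 < seq_weight t * fixed_strategy y t" if "t \<in> S" for t
      using fixed_strategy_pos[OF y that] seq_weight_ge_1[OF that] by simp
    show "(\<Sum>t\<in>S. seq_weight t * fixed_strategy y t) = card S"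
      using sum_seq_weight_strategy[OF fs(1), of None] strategiesD(3)[OF fs(1)]
      by (simp add: below_None)
  qed
  have "seq_weight t * fixed_strategy x' t
      \<le> c ^ (2 * card S) * (seq_weight t * fixed_strategy x t)"
    by (rule stationary_perturbation[OF finite_sequences kernel_positive_stochastic[OF x]
          kernel_positive_stochastic[OF x'] kernel_le[OF le(1)] kernel_le[OF le(2)] c
          stat[OF x] pos[OF x] stat[OF x'] pos[OF x'] _ True])
      (auto simp: mass x x')
  then have "seq_weight t * fixed_strategy x' t
      \<le> seq_weight t * (c ^ (2 * card S) * fixed_strategy x t)"
    by (simp add: mult_ac)
  then show ?thesis using seq_weight_ge_1[OF True] by simp
next
  case False
  then show ?thesis
    using strategiesD(2)[OF fixed_strategy(1)[OF x]] strategiesD(2)[OF fixed_strategy(1)[OF x']]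
    by simp
qed

end

section \<open>The learning algorithm\<close>

context recall_tree begin

abbreviation learning_rate :: "nat \<Rightarrow> real" where
  "learning_rate T \<equiv> real T powr (- 1 / 4)"

definition play_weights ::
    "nat \<Rightarrow> (sequence \<times> strategy \<Rightarrow> real) \<times> (sequence \<times> strategy \<Rightarrow> real) \<Rightarrow> sequence \<times> strategy \<Rightarrow> real" where
  "play_weights T Lm = softmax deviations (learning_rate T) (\<lambda>d. fst Lm d + snd Lm d)"

text \<open>The state consists of the accumulated utilities of the deviations and of their utilities in
  the last round, which serve as prediction for the next round.\<close>

definition learn ::
    "nat \<Rightarrow> (sequence \<times> strategy \<Rightarrow> real) \<times> (sequence \<times> strategy \<Rightarrow> real) \<Rightarrow> utility_fun \<Rightarrow>
     (sequence \<times> strategy \<Rightarrow> real) \<times> (sequence \<times> strategy \<Rightarrow> real)" where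
  "learn T Lm l = (let U = \<lambda>d. l (deviate d (fixed_strategy (play_weights T Lm)))
     in (\<lambda>d. fst Lm d + U d, U))"

definition learner :: algorithm where
  "learner T ls = fixed_strategy (play_weights T (foldl (learn T) (\<lambda>_. 0, \<lambda>_. 0) ls))"

section \<open>Regret of the algorithm against arbitrary utilities\<close>

lemma mixing_play_weights: "mixing_weights (play_weights T Lm)"
  using finite_deviations deviations_nonempty
  by (simp add: mixing_weights_def play_weights_def softmax_pos sum_softmax)

lemma learner_in_strategies: "learner T ls \<in> strategies D"
  unfolding learner_def by (intro fixed_strategy mixing_play_weights)

lemma learning_algorithm_learner: "learning_algorithm D learner"
  by (simp add: learning_algorithm_def learner_in_strategies)

lemma linear_utility_mixture:
  assumes l: "linear_utility D l" and x: "mixing_weights x" and q: "q \<in> strategies D"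
  shows "l (mixture x q) = (\<Sum>d\<in>deviations. x d * l (deviate d q))"
proof -
  obtain g where g: "\<And>q. q \<in> strategies D \<Longrightarrow> l q = (\<Sum>t\<in>S. g t * q t)"
    using l by (auto simp: linear_utility_def)
  have "l (mixture x q) = (\<Sum>t\<in>S. \<Sum>d\<in>deviations. x d * (g t * deviate d q t))"
    using g[OF mixture_in_strategies[OF x q]]
    by (simp add: mixture_def sum_distrib_left mult.left_commute)
  also have "\<dots> = (\<Sum>d\<in>deviations. x d * l (deviate d q))"
    using g deviation_in_strategies[OF _ q] by (subst sum.swap) (simp add: sum_distrib_left)
  finally show ?thesis .
qed

context
  fixes l :: "nat \<Rightarrow> utility_fun" and T :: nat
begin

definition state where
  "state t = foldl (learn T) (\<lambda>_. 0, \<lambda>_. 0) (map l [0..<t])"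

definition played :: "nat \<Rightarrow> strategy" where
  "played t = learner T (map l [0..<t])"

definition dev_utility :: "nat \<Rightarrow> sequence \<times> strategy \<Rightarrow> real" where
  "dev_utility t d = l t (deviate d (played t))"

lemma state_0: "state 0 = (\<lambda>_. 0, \<lambda>_. 0)"
  by (simp add: state_def)

lemma played_eq: "played t = fixed_strategy (play_weights T (state t))"
  by (simp add: played_def learner_def state_def)

lemma state_Suc: "state (Suc t) = (\<lambda>d. fst (state t) d + dev_utility t d, dev_utility t)"
  by (auto simp: state_def learn_def Let_def dev_utility_def played_def learner_def)

lemma played_in_strategies: "played t \<in> strategies D"
  by (simp add: played_def learner_in_strategies)

text \<open>The reduction of regret against deviations to regret over experts: since the played
  strategy is fixed by the mixture, the average utility of the deviations under the weights equals
  the utility of the strategy itself.\<close>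

lemma learner_regret:
  assumes T: "0 < T" and lin: "\<And>t. t < T \<Longrightarrow> linear_utility D (l t)"
    and err: "\<And>t d. t < T \<Longrightarrow> d \<in> deviations \<Longrightarrow> \<bar>dev_utility t d - snd (state t) d\<bar> \<le> e t"
    and f: "f \<in> trigger_deviations D"
  shows "regret_against learner T l f
    \<le> 2 * card S * real T powr (1 / 4) + 4 * learning_rate T * (\<Sum>t<T. (e t)\<^sup>2)"
proof -
  obtain s r where d: "(s, r) \<in> deviations"
    and f_eq: "\<And>q. q \<in> strategies D \<Longrightarrow> f q = deviate (s, r) q"
    using trigger_deviation_deviate[OF f] by blast
  have rate: "0 < learning_rate T" using T by simp
  have played_value: "(\<Sum>d\<in>deviations. play_weights T (state t) d * dev_utility t d) = l t (played t)"
    if "t < T" for t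
    using linear_utility_mixture[OF lin[OF that] mixing_play_weights[of T "state t"]
        played_in_strategies[of t]] fixed_strategy(2)[OF mixing_play_weights, of T "state t"]
    unfolding dev_utility_def by (simp add: played_eq)
  have "regret_against learner T l f = (\<Sum>t<T. dev_utility t (s, r))
      - (\<Sum>t<T. \<Sum>d\<in>deviations. play_weights T (state t) d * dev_utility t d)"
    using f_eq[OF played_in_strategies] played_value
    unfolding regret_against_def played_def[symmetric] dev_utility_def by simp
  also have "\<dots> \<le> ln (card deviations) / learning_rate T + 4 * learning_rate T * (\<Sum>t<T. (e t)\<^sup>2)"
    unfolding play_weights_def
    using optimistic_softmax_regret[OF finite_deviations rate d,
        of "\<lambda>t. fst (state t)" dev_utility T "\<lambda>t. snd (state t)" e] err
    by (simp add: state_0 state_Suc)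
  also have "ln (card deviations) / learning_rate T \<le> 2 * card S * real T powr (1 / 4)"
  proof -
    have "0 < card deviations"
      using finite_deviations deviations_nonempty by (simp add: card_gt_0_iff)
    then have "ln (card deviations) \<le> ln (2 ^ (2 * card S) :: real)"
      using card_deviations by (intro ln_mono) (auto simp: numeral_power_le_of_nat_cancel_iff of_nat_le_numeral_power_cancel_iff)
    also have "\<dots> = real (2 * card S) * ln 2" by (simp add: ln_realpow)
    also have "\<dots> \<le> real (2 * card S) * 1"
      using ln_2_less_1 by (intro mult_left_mono) auto
    finally have "ln (card deviations) * real T powr (1 / 4) \<le> 2 * card S * real T powr (1 / 4)"
      by (intro mult_right_mono) auto
    then show ?thesis by (simp add: powr_minus_divide)
  qed
  finally show ?thesis by simp
qed

section \<open>Stability of play under bounded utilities\<close>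

context
  fixes B :: real
  assumes bounded: "\<And>t q. t < T \<Longrightarrow> q \<in> strategies D \<Longrightarrow> \<bar>l t q\<bar> \<le> B"
begin

lemma dev_utility_bounded: "t < T \<Longrightarrow> d \<in> deviations \<Longrightarrow> \<bar>dev_utility t d\<bar> \<le> B"
  unfolding dev_utility_def by (intro bounded deviation_in_strategies played_in_strategies)

lemma bound_nonneg: "0 < T \<Longrightarrow> 0 \<le> B"
  using bounded[OF _ played_in_strategies, of 0] abs_ge_zero order_trans by blast

lemma prediction_bounded:
  assumes "t < T" "d \<in> deviations"
  shows "\<bar>snd (state t) d\<bar> \<le> B"
proof (cases t)
  case 0
  then show ?thesis using bound_nonneg assms by (simp add: state_0)
next
  case (Suc k)
  then show ?thesis using dev_utility_bounded[of k d] assms by (simp add: state_Suc)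
qed

text \<open>A score changes by twice the new utility minus the old prediction, hence by at most
  \<open>3 * B\<close>; the softmax doubles this in the exponent.\<close>

lemma play_weights_stable:
  assumes t: "t < T" and d: "d \<in> deviations"
  shows "play_weights T (state (Suc t)) d
      \<le> exp (6 * learning_rate T * B) * play_weights T (state t) d"
    "play_weights T (state t) d
      \<le> exp (6 * learning_rate T * B) * play_weights T (state (Suc t)) d"
proof -
  define w where "w t d = fst (state t) d + snd (state t) d" for t d
  have diff: "\<bar>w (Suc t) k - w t k\<bar> \<le> 3 * B" if "k \<in> deviations" for k
    using dev_utility_bounded[OF t that] prediction_bounded[OF t that]
    by (simp add: w_def state_Suc)
  have diff': "\<bar>w t k - w (Suc t) k\<bar> \<le> 3 * B" if "k \<in> deviations" for k
    using diff[OF that] by (simp add: abs_minus_commute)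
  have e: "2 * learning_rate T * (3 * B) = 6 * learning_rate T * B" by simp
  show "play_weights T (state (Suc t)) d
      \<le> exp (6 * learning_rate T * B) * play_weights T (state t) d"
    using softmax_perturbation[OF finite_deviations deviations_nonempty _ d diff, of "learning_rate T"]
    unfolding play_weights_def w_def[symmetric] e by simp
  show "play_weights T (state t) d
      \<le> exp (6 * learning_rate T * B) * play_weights T (state (Suc t)) d"
    using softmax_perturbation[OF finite_deviations deviations_nonempty _ d diff', of "learning_rate T"]
    unfolding play_weights_def w_def[symmetric] e by simp
qed

text \<open>The exponent 12 is the 6 for the weights times the 2 from the perturbation of stationary
  vectors.\<close>

lemma played_stable:
  assumes t: "t < T"
  shows "played (Suc t) u \<le> exp (12 * card S * learning_rate T * B) * played t u"
    "played t u \<le> exp (12 * card S * learning_rate T * B) * played (Suc t) u"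
proof -
  let ?c = "exp (6 * learning_rate T * B)"
  have c: "1 \<le> ?c" using bound_nonneg t by simp
  have pow: "?c ^ (2 * card S) = exp (12 * card S * learning_rate T * B)"
    by (simp flip: exp_of_nat_mult)
  show "played (Suc t) u \<le> exp (12 * card S * learning_rate T * B) * played t u"
    "played t u \<le> exp (12 * card S * learning_rate T * B) * played (Suc t) u"
    unfolding played_eq pow[symmetric]
    by (intro fixed_strategy_perturbation mixing_play_weights c play_weights_stable t; assumption)+
qed

end

end

text \<open>Against arbitrary utilities the prediction error is only known to be at most
  \<open>2 * B\<close>, which gives the order \<open>T powr (3/4)\<close>. The order
  \<open>T powr (1/4)\<close> comes from stability when all players use the algorithm.\<close>

lemma no_regret_learner: "no_regret D learner"
  unfolding no_regret_def
proof
  fix B :: real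
  define R where "R T = 2 * card S * real T powr (1 / 4) + 16 * B\<^sup>2 * real T powr (3 / 4)" for T :: nat
  have "R \<in> o(\<lambda>T. real T)" unfolding R_def by real_asymp
  moreover have "regret_against learner T l f \<le> R T"
    if l: "\<forall>t<T. linear_utility D (l t) \<and> (\<forall>q\<in>strategies D. \<bar>l t q\<bar> \<le> B)"
      and f: "f \<in> trigger_deviations D" for T l f
  proof (cases "T = 0")
    case True
    then show ?thesis by (simp add: regret_against_def R_def)
  next
    case False
    then have T: "0 < T" by simp
    have bnd: "\<And>t q. t < T \<Longrightarrow> q \<in> strategies D \<Longrightarrow> \<bar>l t q\<bar> \<le> B" using l by blast
    have "regret_against learner T l f \<le> 2 * card S * real T powr (1 / 4)
        + 4 * learning_rate T * (\<Sum>t<T. (2 * B)\<^sup>2)"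
    proof (rule learner_regret[OF T _ _ f])
      show "linear_utility D (l t)" if "t < T" for t using l that by blast
      show "\<bar>dev_utility l T t d - snd (state l T t) d\<bar> \<le> 2 * B" if "t < T" "d \<in> deviations" for t d
        using dev_utility_bounded[of T l B t d] prediction_bounded[of T l B t d] bnd that by auto
    qed
    also have "4 * learning_rate T * (\<Sum>t<T. (2 * B)\<^sup>2) = 16 * B\<^sup>2 * (real T * learning_rate T)"
      by (simp add: power_mult_distrib)
    also have "real T * learning_rate T = real T powr (3 / 4)"
      using T by (simp add: powr_mult_base)
    finally show ?thesis by (simp add: R_def)
  qed
  ultimately show "\<exists>R. R \<in> o(\<lambda>T. real T) \<and>
        (\<forall>T l. (\<forall>t<T. linear_utility D (l t) \<and> (\<forall>q \<in> strategies D. \<bar>l t q\<bar> \<le> B)) \<longrightarrow>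
           (\<forall>f \<in> trigger_deviations D. regret_against learner T l f \<le> R T))"
    by blast
qed

end

section \<open>Games with perfect recall\<close>

lemma own_history_Nil [simp]: "own_history G i [] = []"
  by (simp add: own_history_def)

lemma own_history_snoc:
  "own_history G i (h @ [a]) =
     own_history G i h @ (if turn G h = Some i then [(info_label G h, a)] else [])"
proof -
  have "filter (\<lambda>k. turn G (take k (h @ [a])) = Some i) [0..<length h]
      = filter (\<lambda>k. turn G (take k h) = Some i) [0..<length h]"
    by (intro filter_cong) auto
  then show ?thesis
    unfolding own_history_def by (auto simp: nth_append intro!: map_cong)
qed

lemma own_history_mono:
  assumes "prefix g h" shows "prefix (own_history G i g) (own_history G i h)"
proof -
  obtain ys where "h = g @ ys" using assms by (auto simp: prefix_def)
  moreover have "prefix (own_history G i g) (own_history G i (g @ ys))"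
  proof (induction ys rule: rev_induct)
    case (snoc y ys)
    then show ?case
      unfolding append_assoc[symmetric] own_history_snoc by (auto intro: prefix_order.trans)
  qed simp
  ultimately show ?thesis by simp
qed

locale recall_game =
  fixes G :: game
  assumes finite_game: "finite_game G" and perfect_recall: "perfect_recall G"
begin

abbreviation tree :: "nat \<Rightarrow> decision_tree" where
  "tree \<equiv> decision_tree_of G"

lemma finite_nodes: "finite (nodes G)"
  and prefix_node: "h \<in> nodes G \<Longrightarrow> prefix g h \<Longrightarrow> g \<in> nodes G"
  and payoff_bounded: "i \<in> players G \<Longrightarrow> z \<in> leaves G \<Longrightarrow> \<bar>payoff G i z\<bar> \<le> 1"
  using finite_game by (auto simp: finite_game_def abs_le_iff)

lemma finite_players: "finite (players G)"
  by (simp add: players_def)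

lemma finite_leaves: "finite (leaves G)"
  using finite_nodes by (simp add: leaves_def)

lemma same_actions:
  "i \<in> players G \<Longrightarrow> h \<in> infoset_nodes G i j \<Longrightarrow> h' \<in> infoset_nodes G i j \<Longrightarrow>
    node_actions G h = node_actions G h'"
  using finite_game unfolding finite_game_def by blast

lemma same_history:
  "i \<in> players G \<Longrightarrow> h \<in> infoset_nodes G i j \<Longrightarrow> h' \<in> infoset_nodes G i j \<Longrightarrow>
    own_history G i h = own_history G i h'"
  using perfect_recall unfolding perfect_recall_def by blast

lemma finite_node_actions: "finite (node_actions G h)"
proof -
  have "node_actions G h \<subseteq> last ` nodes G" by (force simp: node_actions_def)
  then show ?thesis using finite_nodes finite_subset by blast
qed

lemma infoset_nodeD:
  assumes "h \<in> infoset_nodes G i j"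
  shows "h \<in> nodes G" "turn G h = Some i" "info_label G h = j" "node_actions G h \<noteq> {}"
  using assms by (auto simp: infoset_nodes_def inner_nodes_def leaves_def)

lemma infoset_nodeI:
  assumes "h @ [a] \<in> nodes G" "turn G h = Some i"
  shows "h \<in> infoset_nodes G i (info_label G h)"
  using assms prefix_node[of "h @ [a]" h]
  by (auto simp: infoset_nodes_def inner_nodes_def leaves_def node_actions_def)

text \<open>Each nonempty prefix of an own history is realised on the path to the node. This
  supplies the closure property of histories in the locale and the link between
  \<open>precedes\<close> and own histories.\<close>

lemma own_history_prefixD:
  assumes "h \<in> nodes G" "prefix (xs @ [(j, a)]) (own_history G i h)"
  shows "\<exists>k\<in>infoset_nodes G i j. prefix (k @ [a]) h \<and> own_history G i k = xs"
  using assms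
proof (induction h rule: rev_induct)
  case (snoc b g)
  have g: "g \<in> nodes G" using snoc.prems prefix_node by (meson prefixI)
  consider "prefix (xs @ [(j, a)]) (own_history G i g)"
    | "turn G g = Some i" "xs @ [(j, a)] = own_history G i g @ [(info_label G g, b)]"
    using snoc.prems(2) by (auto simp: own_history_snoc split: if_splits)
  then show ?case
  proof cases
    case 1
    then obtain k where "k \<in> infoset_nodes G i j" "prefix (k @ [a]) g" "own_history G i k = xs"
      using snoc.IH g by blast
    then show ?thesis using prefix_order.trans[of "k @ [a]" g "g @ [b]"] by auto
  next
    case 2
    then show ?thesis using infoset_nodeI[OF snoc.prems(1)] by (intro bexI[of _ g]) auto
  qed
qed simp

definition infoset_history :: "nat \<Rightarrow> nat \<Rightarrow> (nat \<times> nat) list" where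
  "infoset_history i j = own_history G i (SOME h. h \<in> infoset_nodes G i j)"

section \<open>From a game to the decision tree of a player\<close>

context
  fixes i assumes i: "i \<in> players G"
begin

lemma mem_infosets: "j \<in> infosets (tree i) \<longleftrightarrow> (\<exists>h. h \<in> infoset_nodes G i j)"
  by (auto simp: decision_tree_of_def Let_def)

lemma infoset_components:
  assumes h: "h \<in> infoset_nodes G i j"
  shows "actions (tree i) j = node_actions G h" "parent (tree i) j = last_sequence G i h"
    "infoset_history i j = own_history G i h"
proof -
  let ?h = "SOME h. h \<in> infoset_nodes G i j"
  have h': "?h \<in> infoset_nodes G i j" using h by (rule someI)
  have ne: "infoset_nodes G i j \<noteq> {}" using h by blast
  show "actions (tree i) j = node_actions G h"
    using same_actions[OF i h h'] ne by (simp add: decision_tree_of_def Let_def)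
  show "parent (tree i) j = last_sequence G i h"
    using same_history[OF i h h'] ne by (simp add: decision_tree_of_def Let_def last_sequence_def)
  show "infoset_history i j = own_history G i h"
    using same_history[OF i h h'] by (simp add: infoset_history_def)
qed

lemma recall_tree: "recall_tree (tree i) (infoset_history i)"
proof
  have "infosets (tree i) \<subseteq> info_label G ` nodes G"
    using mem_infosets infoset_nodeD by (metis image_eqI subsetI)
  then show "finite (infosets (tree i))" using finite_nodes finite_subset by blast
next
  fix j assume "j \<in> infosets (tree i)"
  then obtain h where h: "h \<in> infoset_nodes G i j" using mem_infosets by blast
  show "finite (actions (tree i) j)" "actions (tree i) j \<noteq> {}"
    using infoset_components[OF h] finite_node_actions infoset_nodeD[OF h] by auto
  show "parent (tree i) j = (if infoset_history i j = [] then None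
      else Some (last (infoset_history i j)))"
    using infoset_components[OF h] by (simp add: last_sequence_def)
next
  fix j xs j' a'
  assume "j \<in> infosets (tree i)" and p: "prefix (xs @ [(j', a')]) (infoset_history i j)"
  then obtain h where h: "h \<in> infoset_nodes G i j" using mem_infosets by blast
  then obtain k where k: "k \<in> infoset_nodes G i j'" "prefix (k @ [a']) h" "own_history G i k = xs"
    using own_history_prefixD[of h] p infoset_components(3)[OF h] infoset_nodeD[OF h] by metis
  have "k @ [a'] \<in> nodes G" using prefix_node infoset_nodeD(1)[OF h] k by blast
  then show "j' \<in> infosets (tree i) \<and> a' \<in> actions (tree i) j' \<and> infoset_history i j' = xs"
    using k infoset_components[OF k(1)] mem_infosets by (auto simp: node_actions_def)
next
  fix j j'
  show "precedes (tree i) j j' \<longleftrightarrow> j \<in> infosets (tree i) \<and> j' \<in> infosets (tree i) \<and>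
      (\<exists>a. (j, a) \<in> set (infoset_history i j'))"
  proof
    assume "precedes (tree i) j j'"
    then obtain h h' where hh: "j \<noteq> j'" "h \<in> infoset_nodes G i j" "h' \<in> infoset_nodes G i j'"
      "prefix h h'"
      by (auto simp: decision_tree_of_def Let_def)
    have "h \<noteq> h'" using hh infoset_nodeD by metis
    then obtain a ys where "h' = (h @ [a]) @ ys"
      using hh(4) by (metis append_Cons append_Nil append_assoc append_Nil2 list.exhaust prefixE)
    then have "prefix (own_history G i (h @ [a])) (own_history G i h')"
      by (intro own_history_mono) simp
    moreover have "own_history G i (h @ [a]) = own_history G i h @ [(j, a)]"
      using infoset_nodeD[OF hh(2)] by (simp add: own_history_snoc)
    ultimately have "(j, a) \<in> set (own_history G i h')"
      using set_mono_prefix by fastforce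
    then show "j \<in> infosets (tree i) \<and> j' \<in> infosets (tree i) \<and>
        (\<exists>a. (j, a) \<in> set (infoset_history i j'))"
      using hh mem_infosets infoset_components(3)[OF hh(3)] by auto
  next
    assume R: "j \<in> infosets (tree i) \<and> j' \<in> infosets (tree i) \<and>
        (\<exists>a. (j, a) \<in> set (infoset_history i j'))"
    then obtain a h' where h': "h' \<in> infoset_nodes G i j'" "(j, a) \<in> set (own_history G i h')"
      using mem_infosets infoset_components(3) by metis
    then obtain xs ys where own: "own_history G i h' = xs @ (j, a) # ys" by (meson split_list)
    then obtain k where k: "k \<in> infoset_nodes G i j" "prefix (k @ [a]) h'" "own_history G i k = xs"
      using own_history_prefixD[of h' xs j a i] infoset_nodeD[OF h'(1)] by (auto simp: prefix_def)
    \<comment> \<open>Otherwise perfect recall would make a history equal to a proper prefix of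
      itself.\<close>
    have "j \<noteq> j'"
    proof
      assume "j = j'"
      then have "own_history G i k = own_history G i h'" using same_history[OF i k(1)] h' by simp
      then show False using own k by simp
    qed
    moreover have "prefix k h'" using k(2) by (meson prefix_order.trans prefixI)
    ultimately show "precedes (tree i) j j'"
      using k h' by (auto simp: decision_tree_of_def Let_def)
  qed
qed

interpretation recall_tree "tree i" "infoset_history i" by (rule recall_tree)

lemma last_sequence_in_sequences:
  assumes z: "z \<in> nodes G" shows "last_sequence G i z \<in> sequences (tree i)"
proof (cases "own_history G i z" rule: rev_cases)
  case Nil
  then show ?thesis by (simp add: last_sequence_def)
next
  case (snoc xs ja)
  obtain j a where ja: "ja = (j, a)" by (cases ja)
  then obtain k where k: "k \<in> infoset_nodes G i j" "prefix (k @ [a]) z"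
    using own_history_prefixD[OF z, of xs j a i] snoc by auto
  have "k @ [a] \<in> nodes G" using prefix_node z k by blast
  then have "j \<in> infosets (tree i)" "a \<in> actions (tree i) j"
    using k mem_infosets infoset_components[OF k(1)] by (auto simp: node_actions_def)
  then show ?thesis using snoc ja by (simp add: last_sequence_def)
qed

text \<open>Every nonempty sequence is the label and action of the last move to some node; the root
  accounts for \<open>None\<close>.\<close>

lemma card_sequences_le: "card (sequences (tree i)) \<le> card (nodes G)"
proof -
  let ?f = "\<lambda>h. if h = [] then None else Some (info_label G (butlast h), last h)"
  have "sequences (tree i) \<subseteq> ?f ` nodes G"
  proof
    fix s assume s: "s \<in> sequences (tree i)"
    show "s \<in> ?f ` nodes G"
    proof (cases s)
      case None
      have "[] \<in> nodes G" using finite_game by (simp add: finite_game_def)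
      then show ?thesis using None by force
    next
      case (Some p)
      obtain j a where ja: "s = Some (j, a)" "j \<in> infosets (tree i)" "a \<in> actions (tree i) j"
        using s Some by (cases p) auto
      then obtain h where h: "h \<in> infoset_nodes G i j" using mem_infosets by blast
      have "h @ [a] \<in> nodes G"
        using ja infoset_components(1)[OF h] by (simp add: node_actions_def)
      moreover have "s = ?f (h @ [a])" using ja infoset_nodeD(3)[OF h] by simp
      ultimately show ?thesis by blast
    qed
  qed
  then show ?thesis using finite_nodes by (meson card_image_le card_mono finite_imageI order_trans)
qed

end

section \<open>Bounds on reach probabilities and utilities\<close>

lemma chance_reach_bounds:
  assumes z: "z \<in> nodes G"
  shows "0 \<le> chance_reach G z" "chance_reach G z \<le> 1"
proof -
  have bnd: "0 \<le> chance_prob G (take k z) (z ! k) \<and> chance_prob G (take k z) (z ! k) \<le> 1"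
    if k: "k < length z" "turn G (take k z) = None" for k
  proof -
    let ?h = "take k z"
    have "?h @ [z ! k] \<in> nodes G"
      using prefix_node[OF z, of "take (Suc k) z"] k by (simp add: take_is_prefix flip: take_Suc_conv_app_nth)
    then have a: "z ! k \<in> node_actions G ?h" by (simp add: node_actions_def)
    moreover have "?h \<in> nodes G" using prefix_node[OF z] by (simp add: take_is_prefix)
    ultimately have "?h \<in> inner_nodes G" by (auto simp: inner_nodes_def leaves_def)
    then have c: "\<forall>a\<in>node_actions G ?h. 0 \<le> chance_prob G ?h a"
      "(\<Sum>a\<in>node_actions G ?h. chance_prob G ?h a) = 1"
      using finite_game k unfolding finite_game_def by blast+
    have "chance_prob G ?h (z ! k) \<le> (\<Sum>a\<in>node_actions G ?h. chance_prob G ?h a)"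
      using a c(1) finite_node_actions by (intro member_le_sum) auto
    then show ?thesis using a c by auto
  qed
  show "0 \<le> chance_reach G z" unfolding chance_reach_def using bnd by (intro prod_nonneg) auto
  show "chance_reach G z \<le> 1" unfolding chance_reach_def using bnd by (intro prod_le_1) auto
qed

lemma leaf_weight_bounded:
  assumes "i \<in> players G" "z \<in> leaves G"
  shows "\<bar>chance_reach G z * payoff G i z\<bar> \<le> 1"
proof -
  have "\<bar>chance_reach G z\<bar> * \<bar>payoff G i z\<bar> \<le> 1 * 1"
    using chance_reach_bounds[of z] payoff_bounded assms
    by (intro mult_mono) (auto simp: leaves_def)
  then show ?thesis by (simp add: abs_mult)
qed

lemma strategy_bounds:
  assumes "k \<in> players G" "q \<in> strategies (tree k)"
  shows "0 \<le> q t" "q t \<le> 1"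
  using recall_tree.strategy_le_1[OF recall_tree[OF assms(1)] assms(2)]
    recall_tree.strategiesD(1)[OF recall_tree[OF assms(1)] assms(2)] by auto

definition strategy_profile :: "profile \<Rightarrow> bool" where
  "strategy_profile p \<longleftrightarrow> (\<forall>k\<in>players G. p k \<in> strategies (tree k))"

lemma reach_bounds:
  assumes "strategy_profile p"
  shows "0 \<le> (\<Prod>k\<in>players G. p k (last_sequence G k z))"
    "(\<Prod>k\<in>players G. p k (last_sequence G k z)) \<le> 1"
proof -
  have "0 \<le> p k t \<and> p k t \<le> 1" if "k \<in> players G" for k t
    using assms strategy_bounds that by (auto simp: strategy_profile_def)
  then show "0 \<le> (\<Prod>k\<in>players G. p k (last_sequence G k z))"
    "(\<Prod>k\<in>players G. p k (last_sequence G k z)) \<le> 1"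
    by (auto intro!: prod_nonneg prod_le_1)
qed

text \<open>Each leaf is bounded by 1 separately, which costs only a polynomial factor.\<close>

lemma expected_utility_bounded:
  assumes i: "i \<in> players G" and p: "strategy_profile p"
  shows "\<bar>expected_utility G i p\<bar> \<le> card (leaves G)"
proof -
  have "\<bar>expected_utility G i p\<bar> \<le> (\<Sum>z\<in>leaves G. \<bar>chance_reach G z * payoff G i z *
        (\<Prod>k\<in>players G. p k (last_sequence G k z))\<bar>)"
    unfolding expected_utility_def by (rule sum_abs)
  also have "\<dots> \<le> (\<Sum>z\<in>leaves G. 1)"
  proof (rule sum_mono)
    fix z assume z: "z \<in> leaves G"
    have "\<bar>chance_reach G z * payoff G i z\<bar> * \<bar>\<Prod>k\<in>players G. p k (last_sequence G k z)\<bar> \<le> 1 * 1"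
      using leaf_weight_bounded[OF i z] reach_bounds[OF p, of z] by (intro mult_mono) auto
    then show "\<bar>chance_reach G z * payoff G i z *
        (\<Prod>k\<in>players G. p k (last_sequence G k z))\<bar> \<le> 1"
      by (simp add: abs_mult)
  qed
  finally show ?thesis by simp
qed

end

text \<open>The larger number is scaled down: \<open>1 - exp (- d) \<le> d\<close> holds for every
  \<open>d\<close>, whereas \<open>exp (d) - 1\<close> would be linear only for small
  \<open>d\<close>.\<close>

lemma abs_diff_le_of_ratio:
  fixes a b d :: real
  assumes "0 \<le> d" "a \<le> 1" "b \<le> 1" "0 \<le> a" "0 \<le> b" "a \<le> exp d * b" "b \<le> exp d * a"
  shows "\<bar>a - b\<bar> \<le> d"
proof -
  have *: "x - y \<le> d" if "0 \<le> x" "x \<le> 1" "x \<le> exp d * y" for x y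
  proof -
    have "exp (- d) * x \<le> exp (- d) * (exp d * y)" using that by (intro mult_left_mono) auto
    then have "exp (- d) * x \<le> y" by (simp flip: exp_add mult.assoc)
    moreover have "1 - d \<le> exp (- d)" using exp_ge_add_one_self[of "- d"] by simp
    then have "(1 - d) * x \<le> exp (- d) * x" using that by (intro mult_right_mono) auto
    ultimately have "x - y \<le> d * x" by (simp add: algebra_simps)
    also have "\<dots> \<le> d" using that assms(1) by (simp add: mult_left_le)
    finally show ?thesis .
  qed
  show ?thesis using *[of a b] *[of b a] assms by (auto simp: abs_le_iff)
qed

section \<open>Equilibrium from stable play\<close>

text \<open>Uncoupledness requires the history to be reconstructed from the decision tree alone; any
  choice will do.\<close>

definition tree_history :: "decision_tree \<Rightarrow> nat \<Rightarrow> (nat \<times> nat) list" where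
  "tree_history D = (SOME h. recall_tree D h)"

definition tree_learner :: "decision_tree \<Rightarrow> algorithm" where
  "tree_learner D = recall_tree.learner D (tree_history D)"

context recall_game begin

lemma recall_tree_history: "i \<in> players G \<Longrightarrow> recall_tree (tree i) (tree_history (tree i))"
  unfolding tree_history_def by (rule someI[of "recall_tree (tree i)"], rule recall_tree)

text \<open>The ratios multiply over the players to \<open>exp (num_players G * e)\<close>; only
  then is the reach of a leaf, which is at most 1, compared by difference.\<close>

lemma expected_utility_stable:
  fixes e :: real
  assumes i: "i \<in> players G" and p: "strategy_profile p" and p': "strategy_profile p'"
    and e: "0 \<le> e"
    and le: "\<And>k t. k \<in> players G \<Longrightarrow> p' k t \<le> exp e * p k t"
      "\<And>k t. k \<in> players G \<Longrightarrow> p k t \<le> exp e * p' k t"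
  shows "\<bar>expected_utility G i p' - expected_utility G i p\<bar> \<le> card (leaves G) * (num_players G * e)"
proof -
  define R where "R p z = (\<Prod>k\<in>players G. p k (last_sequence G k z))" for p :: profile and z
  have ratio: "R q' z \<le> exp (num_players G * e) * R q z"
    if "strategy_profile q'" "\<And>k t. k \<in> players G \<Longrightarrow> q' k t \<le> exp e * q k t" for q q' z
  proof -
    have "R q' z \<le> (\<Prod>k\<in>players G. exp e * q k (last_sequence G k z))"
      unfolding R_def using that strategy_bounds
      by (intro prod_mono) (auto simp: strategy_profile_def)
    also have "\<dots> = exp (num_players G * e) * R q z"
      by (simp add: R_def prod.distrib players_def exp_of_nat_mult)
    finally show ?thesis .
  qed
  have R: "\<bar>R p' z - R p z\<bar> \<le> num_players G * e" for z
    using reach_bounds[OF p, of z] reach_bounds[OF p', of z] ratio[OF p' le(1), of z]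
      ratio[OF p le(2), of z] e
    by (intro abs_diff_le_of_ratio) (auto simp: R_def)
  have "expected_utility G i p' - expected_utility G i p
      = (\<Sum>z\<in>leaves G. chance_reach G z * payoff G i z * (R p' z - R p z))"
    by (simp add: expected_utility_def R_def right_diff_distrib sum_subtractf)
  also have "\<bar>\<dots>\<bar> \<le> (\<Sum>z\<in>leaves G. \<bar>chance_reach G z * payoff G i z * (R p' z - R p z)\<bar>)"
    by (rule sum_abs)
  also have "\<dots> \<le> (\<Sum>z\<in>leaves G. 1 * (num_players G * e))"
  proof (rule sum_mono)
    fix z assume z: "z \<in> leaves G"
    have "\<bar>chance_reach G z * payoff G i z\<bar> * \<bar>R p' z - R p z\<bar> \<le> 1 * (num_players G * e)"
      using leaf_weight_bounded[OF i z] R[of z] by (intro mult_mono) auto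
    then show "\<bar>chance_reach G z * payoff G i z * (R p' z - R p z)\<bar> \<le> 1 * (num_players G * e)"
      by (simp add: abs_mult)
  qed
  finally show ?thesis by simp
qed

text \<open>Grouping the leaves by the player's last sequence exposes the coefficients.\<close>

lemma linear_utility_observed:
  assumes i: "i \<in> players G"
  shows "linear_utility (tree i) (observed_utility G i q)"
proof -
  define c where "c z = chance_reach G z * payoff G i z *
    (\<Prod>k\<in>players G - {i}. q k (last_sequence G k z))" for z
  define g where "g s = (\<Sum>z | z \<in> leaves G \<and> last_sequence G i z = s. c z)" for s
  have "expected_utility G i (q(i := x)) = (\<Sum>s\<in>sequences (tree i). g s * x s)" for x
  proof -
    have "expected_utility G i (q(i := x)) = (\<Sum>z\<in>leaves G. c z * x (last_sequence G i z))"
      unfolding expected_utility_def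
    proof (rule sum.cong[OF refl])
      fix z
      have "(\<Prod>k\<in>players G. (q(i := x)) k (last_sequence G k z))
          = x (last_sequence G i z) * (\<Prod>k\<in>players G - {i}. q k (last_sequence G k z))"
        using finite_players i by (simp add: prod.remove)
      then show "chance_reach G z * payoff G i z * (\<Prod>k\<in>players G. (q(i := x)) k (last_sequence G k z))
          = c z * x (last_sequence G i z)"
        by (simp add: c_def)
    qed
    also have "\<dots> = (\<Sum>s\<in>sequences (tree i).
        \<Sum>z | z \<in> leaves G \<and> last_sequence G i z = s. c z * x (last_sequence G i z))"
      using last_sequence_in_sequences[OF i] finite_leaves
        recall_tree.finite_sequences[OF recall_tree[OF i]]
      by (intro sum.group[symmetric]) (auto simp: leaves_def)
    also have "\<dots> = (\<Sum>s\<in>sequences (tree i). g s * x s)"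
      unfolding g_def sum_distrib_right by (intro sum.cong refl) auto
    finally show ?thesis .
  qed
  then show ?thesis unfolding linear_utility_def observed_utility_def by auto
qed

section \<open>Expectations under independent randomisation of the players\<close>

lemma finite_support:
  assumes "k \<in> players G" "set_pmf \<nu> \<subseteq> pure_strategies (tree k)"
  shows "finite (set_pmf \<nu>)"
proof -
  interpret recall_tree "tree k" "infoset_history k" by (rule recall_tree[OF assms(1)])
  show ?thesis using assms(2) finite_responses[of None] by (auto intro: finite_subset)
qed

lemma finite_support_Pi:
  assumes "\<And>k. k \<in> players G \<Longrightarrow> set_pmf (\<nu> k) \<subseteq> pure_strategies (tree k)"
  shows "finite (set_pmf (Pi_pmf (players G) undefined \<nu>))"
proof (rule finite_subset[OF set_Pi_pmf_subset'[OF finite_players]])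
  show "finite (PiE_dflt (players G) undefined (set_pmf \<circ> \<nu>))"
    using finite_players finite_support assms by (intro finite_PiE_dflt) auto
qed

text \<open>Utility is a sum over leaves of products with one factor per player, so independence
  reduces everything to the means. The maps \<open>F k\<close> allow the deviated and the original
  profile to be treated alike.\<close>

lemma expectation_Pi_expected_utility:
  fixes \<nu> :: "nat \<Rightarrow> strategy pmf"
  assumes \<nu>: "\<And>k. k \<in> players G \<Longrightarrow> set_pmf (\<nu> k) \<subseteq> pure_strategies (tree k)"
    and F: "\<And>k x. k \<in> players G \<Longrightarrow> x \<in> strategies (tree k) \<Longrightarrow> F k x \<in> strategies (tree k)"
    and q: "\<And>k s. k \<in> players G \<Longrightarrow> s \<in> sequences (tree k) \<Longrightarrow>
      measure_pmf.expectation (\<nu> k) (\<lambda>x. F k x s) = q k s"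
  shows "measure_pmf.expectation (Pi_pmf (players G) undefined \<nu>)
      (\<lambda>p. expected_utility G i (\<lambda>k. F k (p k))) = expected_utility G i q"
proof -
  note fin = finite_support[OF _ \<nu>] and finP = finite_support_Pi[OF \<nu>]
  have "measure_pmf.expectation (Pi_pmf (players G) undefined \<nu>)
      (\<lambda>p. expected_utility G i (\<lambda>k. F k (p k)))
    = (\<Sum>z\<in>leaves G. chance_reach G z * payoff G i z *
        measure_pmf.expectation (Pi_pmf (players G) undefined \<nu>)
          (\<lambda>p. \<Prod>k\<in>players G. F k (p k) (last_sequence G k z)))"
    unfolding expected_utility_def
    by (subst Bochner_Integration.integral_sum)
      (auto intro!: integrable_measure_pmf_finite finP)
  also have "\<dots> = (\<Sum>z\<in>leaves G. chance_reach G z * payoff G i z *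
      (\<Prod>k\<in>players G. q k (last_sequence G k z)))"
  proof (rule sum.cong[OF refl])
    fix z assume z: "z \<in> leaves G"
    have "measure_pmf.expectation (Pi_pmf (players G) undefined \<nu>)
          (\<lambda>p. \<Prod>k\<in>players G. F k (p k) (last_sequence G k z))
      = (\<Prod>k\<in>players G. measure_pmf.expectation (\<nu> k) (\<lambda>x. F k x (last_sequence G k z)))"
    proof (rule expectation_prod_Pi_pmf[OF finite_players])
      show "integrable (measure_pmf (\<nu> k)) (\<lambda>x. F k x (last_sequence G k z))" if "k \<in> players G" for k
        using fin[OF that that] by (rule integrable_measure_pmf_finite)
      show "0 \<le> F k x (last_sequence G k z)" if "k \<in> players G" "x \<in> set_pmf (\<nu> k)" for k x
      proof -
        have "x \<in> strategies (tree k)"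
          using \<nu>[OF that(1)] that(2) by (auto simp: pure_strategies_def)
        then show ?thesis using strategy_bounds(1)[OF that(1) F[OF that(1)]] by blast
      qed
    qed
    also have "\<dots> = (\<Prod>k\<in>players G. q k (last_sequence G k z))"
      using q last_sequence_in_sequences z by (intro prod.cong) (auto simp: leaves_def)
    finally show "chance_reach G z * payoff G i z *
        measure_pmf.expectation (Pi_pmf (players G) undefined \<nu>)
          (\<lambda>p. \<Prod>k\<in>players G. F k (p k) (last_sequence G k z))
      = chance_reach G z * payoff G i z * (\<Prod>k\<in>players G. q k (last_sequence G k z))"
      by simp
  qed
  finally show ?thesis by (simp add: expected_utility_def)
qed

text \<open>On the support the deviation agrees with \<open>deviate\<close>, whose coordinate
  \<open>t\<close> is a linear combination of the coordinates \<open>s\<close> and \<open>t\<close>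
  of its argument. Hence it commutes with the mean, whichever distribution represents the played
  strategy.\<close>

lemma expectation_deviation:
  assumes i: "i \<in> players G"
    and \<nu>: "\<And>k. k \<in> players G \<Longrightarrow> set_pmf (\<nu> k) \<subseteq> pure_strategies (tree k)"
    and q: "strategy_profile q" "\<And>k s. k \<in> players G \<Longrightarrow> s \<in> sequences (tree k) \<Longrightarrow>
      measure_pmf.expectation (\<nu> k) (\<lambda>x. x s) = q k s"
    and f: "f \<in> trigger_deviations (tree i)"
  shows "measure_pmf.expectation (Pi_pmf (players G) undefined \<nu>)
      (\<lambda>p. expected_utility G i (p(i := f (p i))) - expected_utility G i p)
    = expected_utility G i (q(i := f (q i))) - expected_utility G i q"
proof -
  interpret recall_tree "tree i" "infoset_history i" by (rule recall_tree[OF i])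
  obtain s r where d: "(s, r) \<in> deviations"
    and f_eq: "\<And>q. q \<in> strategies (tree i) \<Longrightarrow> f q = deviate (s, r) q"
    using trigger_deviation_deviate[OF f] by blast
  have s: "s \<in> sequences (tree i)" using d by (simp add: deviations_def)
  note fin = finite_support[OF _ \<nu>] and finP = finite_support_Pi[OF \<nu>]
  define F where "F k = (if k = i then f else id)" for k
  have upd: "(\<lambda>k. F k (p k)) = p(i := f (p i))" for p by (auto simp: F_def)
  have "measure_pmf.expectation (Pi_pmf (players G) undefined \<nu>)
      (\<lambda>p. expected_utility G i (\<lambda>k. F k (p k))) = expected_utility G i (q(i := f (q i)))"
  proof (rule expectation_Pi_expected_utility[OF \<nu>])
    show "F k x \<in> strategies (tree k)" if "k \<in> players G" "x \<in> strategies (tree k)" for k x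
      using that f_eq deviation_in_strategies[OF d] by (auto simp: F_def)
    fix k t assume k: "k \<in> players G" and t: "t \<in> sequences (tree k)"
    show "measure_pmf.expectation (\<nu> k) (\<lambda>x. F k x t) = (q(i := f (q i))) k t"
    proof (cases "k = i")
      case True
      have qi: "q i \<in> strategies (tree i)" using q i by (simp add: strategy_profile_def)
      have "measure_pmf.expectation (\<nu> i) (\<lambda>x. F i x t)
          = measure_pmf.expectation (\<nu> i) (\<lambda>x. r t * x s + (if t \<in> below s then 0 else 1) * x t)"
        using \<nu>[OF i] f_eq
        by (intro integral_cong_AE)
          (auto simp: F_def AE_measure_pmf_iff deviate.simps pure_strategies_def)
      also have "\<dots> = r t * measure_pmf.expectation (\<nu> i) (\<lambda>x. x s)
          + (if t \<in> below s then 0 else 1) * measure_pmf.expectation (\<nu> i) (\<lambda>x. x t)"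
        using fin[OF i i]
        by (subst Bochner_Integration.integral_add) (auto intro!: integrable_measure_pmf_finite)
      also have "\<dots> = f (q i) t"
        using q(2)[OF i] s t f_eq[OF qi] True by (simp add: deviate.simps)
      finally show ?thesis using True by simp
    next
      case False
      then show ?thesis using q(2)[OF k t] by (simp add: F_def)
    qed
  qed auto
  moreover have "measure_pmf.expectation (Pi_pmf (players G) undefined \<nu>)
      (\<lambda>p. expected_utility G i (\<lambda>k. id (p k))) = expected_utility G i q"
    by (rule expectation_Pi_expected_utility[OF \<nu>]) (use q(2) in auto)
  ultimately show ?thesis
    using finP by (simp add: upd integrable_measure_pmf_finite)
qed

section \<open>All players using the algorithm\<close>

context
  fixes A :: "nat \<Rightarrow> algorithm" and T :: nat
  assumes A: "\<And>k. k \<in> players G \<Longrightarrow> A k = tree_learner (tree k)" and T: "1 \<le> T"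
begin

abbreviation observed :: "nat \<Rightarrow> nat \<Rightarrow> utility_fun" where
  "observed k t \<equiv> observed_utility G k (play G A T t)"

lemma play_eq:
  "k \<in> players G \<Longrightarrow>
    play G A T t k = recall_tree.played (tree k) (tree_history (tree k)) (observed k) T t"
  by (subst play.simps) (simp add: A tree_learner_def recall_tree.played_def[OF recall_tree_history])

lemma strategy_profile_play: "strategy_profile (play G A T t)"
  using recall_tree.played_in_strategies[OF recall_tree_history]
  by (simp add: strategy_profile_def play_eq)

lemma card_leaves_le: "card (leaves G) \<le> game_size G"
  using card_mono[of "nodes G" "leaves G"] finite_nodes by (auto simp: game_size_def leaves_def)

lemma observed_bounded:
  assumes k: "k \<in> players G" and q: "q \<in> strategies (tree k)"
  shows "\<bar>observed k t q\<bar> \<le> game_size G"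
proof -
  have "strategy_profile ((play G A T t)(k := q))"
    using strategy_profile_play[of t] q by (simp add: strategy_profile_def)
  from expected_utility_bounded[OF k this] show ?thesis
    using q card_leaves_le by (simp add: observed_utility_def)
qed

text \<open>Both the number of sequences and the bound on the utilities are at most the size of the
  game; hence the square.\<close>

lemma play_stable:
  assumes k: "k \<in> players G" and t: "t < T"
  defines "e \<equiv> 12 * real (game_size G) ^ 2 * real T powr (- 1 / 4)"
  shows "play G A T (Suc t) k u \<le> exp e * play G A T t k u"
    "play G A T t k u \<le> exp e * play G A T (Suc t) k u"
proof -
  interpret recall_tree "tree k" "tree_history (tree k)" by (rule recall_tree_history[OF k])
  let ?c = "12 * real (card (sequences (tree k))) * real T powr (- 1 / 4) * real (game_size G)"
  have "real (card (sequences (tree k))) \<le> game_size G"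
    using card_sequences_le[OF k] by (simp add: game_size_def)
  then have "?c \<le> 12 * real (game_size G) * real T powr (- 1 / 4) * real (game_size G)"
    by (intro mult_right_mono mult_left_mono) auto
  then have ce: "exp ?c \<le> exp e" by (simp add: e_def power2_eq_square mult_ac)
  have nonneg: "0 \<le> play G A T t k u" for t
    using strategy_profile_play[of t] k strategiesD(1) by (simp add: strategy_profile_def)
  have st: "play G A T (Suc t) k u \<le> exp ?c * play G A T t k u"
    "play G A T t k u \<le> exp ?c * play G A T (Suc t) k u"
    unfolding play_eq[OF k] using played_stable[of T "observed k" "game_size G" t u] observed_bounded[OF k] t
    by auto
  show "play G A T (Suc t) k u \<le> exp e * play G A T t k u"
    using st(1) mult_right_mono[OF ce nonneg[of t]] by linarith
  show "play G A T t k u \<le> exp e * play G A T (Suc t) k u"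
    using st(2) mult_right_mono[OF ce nonneg[of "Suc t"]] by linarith
qed

text \<open>The three terms are the logarithm of the number of deviations, the first round, and the
  later rounds. The last is \<open>4 * \<eta> * T * (12 * N ^ 4 * \<eta>)^2\<close>, so 576 is
  \<open>4 * 12^2\<close>, and \<open>T * \<eta> ^ 3\<close> is \<open>T powr (1/4)\<close>.\<close>

lemma regret_in_play:
  assumes i: "i \<in> players G" and f: "f \<in> trigger_deviations (tree i)"
  defines "N \<equiv> real (game_size G)"
  shows "regret_against (A i) T (observed i) f \<le> (2 * N + 4 * N ^ 2 + 576 * N ^ 8) * real T powr (1 / 4)"
proof -
  interpret recall_tree "tree i" "tree_history (tree i)" by (rule recall_tree_history[OF i])
  define \<eta> where "\<eta> = real T powr (- 1 / 4)"
  have \<eta>: "0 < \<eta>" using T by (simp add: \<eta>_def)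
  \<comment> \<open>Round 0 is predicted by 0, so its error is the whole utility. Afterwards play
    moves by the exponent \<open>12 * N^2 * \<eta>\<close>, and passing to utilities costs one
    factor \<open>N\<close> for the leaves and one for the players.\<close>
  define e where "e t = (if t = 0 then N else 12 * N ^ 4 * \<eta>)" for t :: nat
  have err: "\<bar>dev_utility (observed i) T t d - snd (state (observed i) T t) d\<bar> \<le> e t"
    if t: "t < T" and d: "d \<in> deviations" for t d
  proof (cases t)
    case 0
    then show ?thesis
      using dev_utility_bounded[of T "observed i" N 0 d] observed_bounded[OF i] t d
      by (simp add: state_0 e_def N_def)
  next
    case (Suc s)
    define p where "p s = (play G A T s)(i := deviate d (play G A T s i))" for s
    have strat: "play G A T s i \<in> strategies (tree i)" for s
      using strategy_profile_play[of s] i by (simp add: strategy_profile_def)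
    have prof: "strategy_profile (p s)" for s
      using strategy_profile_play[of s] deviation_in_strategies[OF d] i
      by (simp add: strategy_profile_def p_def)
    have value_eq: "dev_utility (observed i) T s d = expected_utility G i (p s)" for s
      using deviation_in_strategies[OF d strat[of s]]
      by (simp add: dev_utility_def observed_utility_def p_def play_eq[OF i])
    define c where "c = 12 * N ^ 2 * \<eta>"
    have c: "0 \<le> c" using \<eta> by (simp add: c_def)
    have step: "play G A T (Suc s) k u \<le> exp c * play G A T s k u"
      "play G A T s k u \<le> exp c * play G A T (Suc s) k u" if "k \<in> players G" for k u
      using play_stable[OF that, of s u] t Suc by (auto simp: c_def N_def \<eta>_def)
    \<comment> \<open>A deviation has nonnegative coefficients and so preserves relative bounds;
      this matters because the opponents and the deviated strategy move at the same time.\<close>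
    have dev: "deviate d y u \<le> exp c * deviate d x u"
      if "\<And>u. y u \<le> exp c * x u" "\<And>u. 0 \<le> x u" for x y u
    proof -
      obtain s r where sr: "d = (s, r)" by (cases d)
      have "0 \<le> r u" using d sr response_nonneg by (auto simp: deviations_def)
      then have "y s * r u \<le> (exp c * x s) * r u" using that by (intro mult_right_mono)
      then show ?thesis using that(1)[of u] that(2)[of u] by (simp add: sr deviate.simps algebra_simps)
    qed
    have dev_step: "deviate d (play G A T (Suc s) i) u \<le> exp c * deviate d (play G A T s i) u"
      "deviate d (play G A T s i) u \<le> exp c * deviate d (play G A T (Suc s) i) u" for u
      by (rule dev, rule step[OF i], rule strategiesD(1)[OF strat])+
    have "\<bar>expected_utility G i (p (Suc s)) - expected_utility G i (p s)\<bar>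
        \<le> card (leaves G) * (num_players G * c)"
    proof (rule expected_utility_stable[OF i prof prof c])
      show "p (Suc s) k u \<le> exp c * p s k u" "p s k u \<le> exp c * p (Suc s) k u"
        if k: "k \<in> players G" for k u
        using step[OF k] dev_step by (auto simp: p_def)
    qed
    also have "\<dots> \<le> N * (N * c)"
      using card_leaves_le c by (intro mult_mono) (auto simp: N_def game_size_def)
    also have "\<dots> = e t" using Suc by (simp add: e_def c_def power2_eq_square power4_eq_xxxx)
    finally show ?thesis by (simp add: Suc state_Suc value_eq)
  qed
  have "regret_against (A i) T (observed i) f
      \<le> 2 * card (sequences (tree i)) * real T powr (1 / 4) + 4 * \<eta> * (\<Sum>t<T. (e t)\<^sup>2)"
    using learner_regret[OF _ _ err f] T linear_utility_observed[OF i]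
    by (simp add: A[OF i] tree_learner_def \<eta>_def)
  also have "\<dots> \<le> 2 * N * real T powr (1 / 4) + 4 * \<eta> * (N ^ 2 + real T * (12 * N ^ 4 * \<eta>)\<^sup>2)"
  proof (intro add_mono mult_right_mono mult_left_mono)
    show "real (2 * card (sequences (tree i))) \<le> 2 * N"
      using card_sequences_le[OF i] by (simp add: N_def game_size_def)
    have "(\<Sum>t<T. (e t)\<^sup>2) \<le> (\<Sum>t<T. (if t = 0 then N ^ 2 else 0) + (12 * N ^ 4 * \<eta>)\<^sup>2)"
      by (intro sum_mono) (auto simp: e_def)
    also have "\<dots> = N ^ 2 + real T * (12 * N ^ 4 * \<eta>)\<^sup>2"
      using T by (simp add: sum.distrib)
    finally show "(\<Sum>t<T. (e t)\<^sup>2) \<le> N ^ 2 + real T * (12 * N ^ 4 * \<eta>)\<^sup>2" .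
  qed (use \<eta> in auto)
  also have "\<dots> = 2 * N * real T powr (1 / 4) + 4 * N ^ 2 * \<eta> + 576 * N ^ 8 * (real T * \<eta> ^ 3)"
    by (simp add: algebra_simps power_mult_distrib power2_eq_square power3_eq_cube flip: power_add)
  also have "real T * \<eta> ^ 3 = real T powr (1 / 4)"
    using T by (simp add: \<eta>_def powr_power powr_mult_base)
  also have "4 * N ^ 2 * \<eta> \<le> 4 * N ^ 2 * real T powr (1 / 4)"
    unfolding \<eta>_def using T by (intro mult_left_mono powr_mono) auto
  finally show ?thesis by (simp add: algebra_simps)
qed

text \<open>The uniform mixture over rounds turns the expected gain of a deviation into the average
  regret against it.\<close>

theorem correlated_play_EFCE:
  assumes \<mu>: "represents_play G A T \<mu>"
  defines "N \<equiv> real (game_size G)"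
  shows "is_EFCE G ((2 * N + 4 * N ^ 2 + 576 * N ^ 8) * real T powr (- 3 / 4)) (correlated_play G T \<mu>)"
  unfolding is_EFCE_def
proof (intro conjI ballI)
  have supp: "set_pmf (\<mu> t k) \<subseteq> pure_strategies (tree k)"
    and mean: "\<And>s. s \<in> sequences (tree k) \<Longrightarrow>
      measure_pmf.expectation (\<mu> t k) (\<lambda>p. p s) = play G A T t k s"
    if "t < T" "k \<in> players G" for t k
    using \<mu> that by (auto simp: represents_play_def)
  have T': "{..<T} \<noteq> {}" using T by (auto simp: lessThan_empty_iff)
  show "set_pmf (correlated_play G T \<mu>) \<subseteq> pure_profiles G"
  proof
    fix p assume "p \<in> set_pmf (correlated_play G T \<mu>)"
    then obtain t where t: "t < T" "p \<in> set_pmf (Pi_pmf (players G) undefined (\<mu> t))"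
      using T' by (auto simp: correlated_play_def)
    then have "p \<in> PiE_dflt (players G) undefined (set_pmf \<circ> \<mu> t)"
      by (intro subsetD[OF set_Pi_pmf_subset'[OF finite_players]])
    then show "p \<in> pure_profiles G"
      using supp[OF t(1)] by (auto simp: pure_profiles_def PiE_dflt_def PiE_iff extensional_def)
  qed
  fix i f assume i: "i \<in> players G" and f: "f \<in> trigger_deviations (tree i)"
  let ?h = "\<lambda>p. expected_utility G i (p(i := f (p i))) - expected_utility G i p"
  have strat: "play G A T t i \<in> strategies (tree i)" for t
    using strategy_profile_play[of t] i by (simp add: strategy_profile_def)
  have f_strat: "f (play G A T t i) \<in> strategies (tree i)" for t
  proof -
    interpret recall_tree "tree i" "infoset_history i" by (rule recall_tree[OF i])
    show ?thesis
      using trigger_deviation_deviate[OF f] deviation_in_strategies strat[of t] by metis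
  qed
  have "measure_pmf.expectation (correlated_play G T \<mu>) ?h
      = (\<Sum>t<T. measure_pmf.expectation (Pi_pmf (players G) undefined (\<mu> t)) ?h /\<^sub>R real (card {..<T}))"
    unfolding correlated_play_def
    using supp by (intro pmf_expectation_bind_pmf_of_set T') (auto intro!: finite_support_Pi)
  also have "\<dots> = (\<Sum>t<T. (observed i t (f (play G A T t i)) - observed i t (play G A T t i)) / T)"
  proof (rule sum.cong[OF refl])
    fix t assume "t \<in> {..<T}"
    then have t: "t < T" by simp
    have "measure_pmf.expectation (Pi_pmf (players G) undefined (\<mu> t)) ?h
        = expected_utility G i ((play G A T t)(i := f (play G A T t i))) - expected_utility G i (play G A T t)"
      by (rule expectation_deviation[OF i supp[OF t] strategy_profile_play mean[OF t] f])
    also have "\<dots> = observed i t (f (play G A T t i)) - observed i t (play G A T t i)"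
      using strat[of t] f_strat[of t] by (simp add: observed_utility_def)
    finally show "measure_pmf.expectation (Pi_pmf (players G) undefined (\<mu> t)) ?h /\<^sub>R real (card {..<T})
        = (observed i t (f (play G A T t i)) - observed i t (play G A T t i)) / T"
      by (simp add: divide_inverse)
  qed
  also have "\<dots> = regret_against (A i) T (observed i) f / T"
  proof -
    have "A i T (map (observed i) [0..<t]) = play G A T t i" for t
      by (subst (2) play.simps) simp
    then show ?thesis
      by (simp add: regret_against_def sum_subtractf flip: sum_divide_distrib)
  qed
  also have "\<dots> \<le> ((2 * N + 4 * N ^ 2 + 576 * N ^ 8) * real T powr (1 / 4)) / T"
    unfolding N_def using regret_in_play[OF i f] by (intro divide_right_mono) auto
  also have "\<dots> = (2 * N + 4 * N ^ 2 + 576 * N ^ 8) * (real T powr (1 / 4) / real T powr 1)"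
    using T by simp
  also have "real T powr (1 / 4) / real T powr 1 = real T powr (- 3 / 4)"
    unfolding powr_diff[symmetric] by simp
  finally show "measure_pmf.expectation (correlated_play G T \<mu>) ?h
      \<le> (2 * N + 4 * N ^ 2 + 576 * N ^ 8) * real T powr (- 3 / 4)" .
qed

end

end

theorem theorem1p1:
  shows "\<exists>P :: real poly. \<exists>dyn :: dynamics. uncoupled dyn \<and>
    (\<forall>G. finite_game G \<and> perfect_recall G \<longrightarrow>
      (\<forall>i \<in> players G. learning_algorithm (decision_tree_of G i) (dyn G i) \<and>
         no_regret (decision_tree_of G i) (dyn G i)) \<and>
      (\<forall>T \<ge> 1. \<forall>\<mu>. represents_play G (dyn G) T \<mu> \<longrightarrow>
         (\<exists>\<epsilon>. \<epsilon> \<le> poly P (real (game_size G)) * real T powr (- 3 / 4) \<and>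
              is_EFCE G \<epsilon> (correlated_play G T \<mu>))))"
proof (intro exI[of _ "monom 2 1 + monom 4 2 + monom 576 8"]
    exI[of _ "\<lambda>G i. tree_learner (decision_tree_of G i)"] conjI allI impI ballI)
  show "uncoupled (\<lambda>G i. tree_learner (decision_tree_of G i))"
    by (auto simp: uncoupled_def)
  fix G assume "finite_game G \<and> perfect_recall G"
  then interpret recall_game G by unfold_locales auto
  show "learning_algorithm (tree i) (tree_learner (tree i))" "no_regret (tree i) (tree_learner (tree i))"
    if "i \<in> players G" for i
    using recall_tree.learning_algorithm_learner[OF recall_tree_history[OF that]]
      recall_tree.no_regret_learner[OF recall_tree_history[OF that]]
    by (simp_all add: tree_learner_def)
  fix T :: nat and \<mu>
  assume "1 \<le> T" "represents_play G (\<lambda>i. tree_learner (tree i)) T \<mu>"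
  then show "\<exists>\<epsilon>. \<epsilon> \<le> poly (monom 2 1 + monom 4 2 + monom 576 8) (real (game_size G)) *
        real T powr (- 3 / 4) \<and> is_EFCE G \<epsilon> (correlated_play G T \<mu>)"
    using correlated_play_EFCE[of "\<lambda>i. tree_learner (tree i)" T \<mu>]
    by (intro exI conjI) (auto simp: poly_monom)
qed

end
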